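(* Let $N\ge 2$, $2\le p<N$, $r_0>e$, $C_H=\left|\frac{p-N}{p}\right|^p$, $C_*=\frac{p-1}{2p}\left|\frac{p-N}{p}\right|^{p-2}$, $\varepsilon\in\,]0,C_*]$, and consider the equation $$-\Delta_p u-\frac{C_H}{|x|^p}|u|^{p-2}u-\frac{\varepsilon}{|x|^p\log^{2}|x|}|u|^{p-2}u=0\quad\text{in }B]r_0,\infty[.$$ Let $\beta_\varepsilon\le\bar\beta_\varepsilon$ be the real roots of $\frac12\left|\frac{p-N}{p}\right|^{p-2}(p-1)(2-\beta p)\beta=\varepsilon$. Then: (a) for every positive (not necessarily radial) $C^2$-supersolution $w$ of the equation and every $\tau<0$ there is $C>0$ with $$|x|^{\frac{p-N}{p}}(\log|x|)^{\beta_\varepsilon}(\log\log|x|)^\tau\le C\,w(x)\quad\text{for all }x\in B[r_0,\infty[;$$ (b) for every positive radial strictly monotone decreasing $C^2$-supersolution $v$ of the equation, $$\limsup_{|x|\to\infty}\frac{|x|^{\frac{p-N}{p}}(\log|x|)^{\bar\beta_\varepsilon}(\log\log|x|)^\tau}{v(x)}>0$$ whenever either $\varepsilon<C_*$ and $\tau>0$, or $\varepsilon=C_*$ and $\tau>2/p$.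
   Context: $\Delta_p u=\nabla\cdot(|\nabla u|^{p-2}\nabla u)$. $B]r_0,\infty[=\{x\in\mathbb{R}^N:|x|>r_0\}$, $B[r_0,\infty[=\{x:|x|\ge r_0\}$. A $C^2$-supersolution is a function $w\in C^2(B[r_0,\infty[)$ for which the left-hand side of the equation evaluated at $w$ is $\ge 0$ pointwise in $B]r_0,\infty[$. A radial function $v(x)=\phi(|x|)$ is strictly monotone decreasing if $\phi'(r)<0$ for all $r\ge r_0$. (For $0<\varepsilon<C_*$ one has $0<\beta_\varepsilon<\frac1p<\bar\beta_\varepsilon<\frac2p$, and for $\varepsilon=C_*$, $\beta_\varepsilon=\bar\beta_\varepsilon=\frac1p$.) *)

theory Defs
  imports "HOL-Analysis.Analysis"
begin

definition dpart :: "(real ^ 'n \<Rightarrow> real) \<Rightarrow> 'n \<Rightarrow> real ^ 'n \<Rightarrow> real" where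
  "dpart f i x = deriv (\<lambda>t. f (x + t *\<^sub>R axis i 1)) 0"

definition grad :: "(real ^ 'n \<Rightarrow> real) \<Rightarrow> real ^ 'n \<Rightarrow> real ^ 'n" where
  "grad u x = (\<chi> i. dpart u i x)"

text \<open>The vector field |grad u|^(p-2) grad u (taken to be 0 where grad u = 0,
  which is the correct value for every p >= 2, including p = 2).\<close>
definition pflux :: "real \<Rightarrow> (real ^ 'n \<Rightarrow> real) \<Rightarrow> real ^ 'n \<Rightarrow> real ^ 'n" where
  "pflux p u x = (if grad u x = 0 then 0 else norm (grad u x) powr (p - 2) *\<^sub>R grad u x)"

definition plap :: "real \<Rightarrow> (real ^ 'n \<Rightarrow> real) \<Rightarrow> real ^ 'n \<Rightarrow> real" where
  "plap p u x = (\<Sum>i\<in>UNIV. dpart (\<lambda>y. pflux p u y $ i) i x)"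

definition C2_on :: "(real ^ 'n) set \<Rightarrow> (real ^ 'n \<Rightarrow> real) \<Rightarrow> bool" where
  "C2_on T u \<longleftrightarrow> open T \<and> u differentiable_on T
     \<and> (\<forall>i. (dpart u i) differentiable_on T)
     \<and> (\<forall>i j. continuous_on T (dpart (dpart u i) j))"

definition C2_ext :: "real \<Rightarrow> (real ^ 'n \<Rightarrow> real) \<Rightarrow> bool" where
  "C2_ext r0 u \<longleftrightarrow> (\<exists>T. {x. norm x \<ge> r0} \<subseteq> T \<and> C2_on T u)"

definition hardy_op :: "real \<Rightarrow> real \<Rightarrow> real \<Rightarrow> (real ^ 'n \<Rightarrow> real) \<Rightarrow> real ^ 'n \<Rightarrow> real" where
  "hardy_op p CH eps u x =
     - plap p u x
     - CH / (norm x powr p) * (\<bar>u x\<bar> powr (p - 2) * u x)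
     - eps / (norm x powr p * (ln (norm x))\<^sup>2) * (\<bar>u x\<bar> powr (p - 2) * u x)"

definition supersol :: "real \<Rightarrow> real \<Rightarrow> real \<Rightarrow> real \<Rightarrow> (real ^ 'n \<Rightarrow> real) \<Rightarrow> bool" where
  "supersol p CH eps r0 w \<longleftrightarrow> C2_ext r0 w \<and> (\<forall>x. norm x > r0 \<longrightarrow> hardy_op p CH eps w x \<ge> 0)"

definition radial_strict_decr :: "real \<Rightarrow> (real ^ 'n \<Rightarrow> real) \<Rightarrow> bool" where
  "radial_strict_decr r0 v \<longleftrightarrow> (\<exists>\<phi>. (\<forall>x. norm x \<ge> r0 \<longrightarrow> v x = \<phi> (norm x)) \<and>
       (\<forall>r\<ge>r0. \<exists>d<0. (\<phi> has_real_derivative d) (at r within {r0..})))"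

end

theory Submission
  imports Defs "HOL-Real_Asymp.Real_Asymp"
begin

text \<open>
  Write \<open>g = (N - p) / p\<close>, \<open>s = ln r\<close>, \<open>t = ln s\<close>. If a radial function \<open>\<phi> > 0\<close> touches a positive
  supersolution from below at a point, then the second derivative test, applied along the
  coordinate axes and along the radius, shows that \<open>h(s) = - r \<phi>'(r) / \<phi>(r)\<close> satisfies the Riccati
  inequality \<open>(p-1) h^(p-2) h' \<ge> F(h) + eps / s^2\<close> there, where
  \<open>F(h) = (p-1) h^p - p g h^(p-1) + g^p\<close> has a double zero at \<open>g\<close>.

  For (a), the functions \<open>r^(-g) s^beta t^\<tau> (T - t)^2\<close> vanish at \<open>t = T\<close> and, for large \<open>s\<close> and uniformly
  in \<open>T\<close>, violate this inequality. Hence the maximum of their quotient by the supersolution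
  over an annulus is attained on the inner sphere, and the choice \<open>T = 2 t(x)\<close> gives the bound at \<open>x\<close>.

  For (b), a decreasing radial supersolution touches itself, so the inequality holds throughout.
  It forces \<open>h \<le> g\<close>, since otherwise \<open>h\<close> blows up in finite time; then \<open>d = s (g - h) - betab\<close> satisfies
  \<open>d' \<le> - (p/2) d (d + betab - beta)\<close> in the variable \<open>t\<close>, and \<open>d\<close> is the logarithmic derivative of
  \<open>v r^g s^(-betab)\<close>, which is therefore bounded if \<open>beta < betab\<close> and \<open>O(t^(2/p))\<close> if \<open>beta = betab\<close>.
\<close>

section \<open>Partial derivatives and derivatives along lines\<close>

lemma has_derivative_dpart:
  assumes "(f has_derivative f') (at x)"
  shows "dpart f i x = f' (axis i 1)"
proof -
  have "((\<lambda>t. f (x + t *\<^sub>R axis i 1)) has_derivative (\<lambda>t. f' (t *\<^sub>R axis i 1))) (at 0)"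
    by (rule has_derivative_compose[where g = f, of "\<lambda>t. x + t *\<^sub>R axis i 1"])
       (auto intro!: derivative_eq_intros simp: assms)
  moreover have "f' (t *\<^sub>R axis i 1) = f' (axis i 1) * t" for t
    using linear_scale[OF has_derivative_linear[OF assms]] by simp
  ultimately show ?thesis
    unfolding dpart_def by (intro DERIV_imp_deriv) (simp add: has_field_derivative_def)
qed

text \<open>Expanding \<open>e\<close> in the coordinate basis reduces a directional derivative to
  partial ones. Arbitrary \<open>e\<close> is allowed because the touching argument also tests the
  radial direction.\<close>

lemma line_has_real_derivative:
  fixes f :: "real ^ 'n \<Rightarrow> real"
  assumes "f differentiable (at (y + t *\<^sub>R e))"
  shows "((\<lambda>t. f (y + t *\<^sub>R e)) has_real_derivative
    (\<Sum>i\<in>UNIV. e $ i * dpart f i (y + t *\<^sub>R e))) (at t)"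
proof -
  obtain f' where f': "(f has_derivative f') (at (y + t *\<^sub>R e))"
    using assms unfolding differentiable_def by blast
  have lin: "linear f'" using has_derivative_linear[OF f'] .
  have "((\<lambda>t. f (y + t *\<^sub>R e)) has_derivative (\<lambda>s. f' (s *\<^sub>R e))) (at t)"
    by (rule has_derivative_compose[where g = f, of "\<lambda>t. y + t *\<^sub>R e"])
       (auto intro!: derivative_eq_intros simp: f')
  moreover have "f' (s *\<^sub>R e) = (\<Sum>i\<in>UNIV. e $ i * f' (axis i 1)) * s" for s
  proof -
    have "f' e = f' (\<Sum>i\<in>UNIV. e $ i *\<^sub>R axis i 1)"
      using basis_expansion[of e] by (simp add: scalar_mult_eq_scaleR)
    also have "\<dots> = (\<Sum>i\<in>UNIV. e $ i * f' (axis i 1))"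
      by (simp add: linear_sum[OF lin] linear_scale[OF lin])
    finally show ?thesis using linear_scale[OF lin] by simp
  qed
  ultimately show ?thesis
    by (simp add: has_field_derivative_def has_derivative_dpart[OF f'])
qed

lemma dpart_has_real_derivative:
  fixes f :: "real ^ 'n \<Rightarrow> real"
  assumes "f differentiable (at x)"
  shows "((\<lambda>t. f (x + t *\<^sub>R axis i 1)) has_real_derivative dpart f i x) (at 0)"
proof -
  have "(\<Sum>j\<in>UNIV. axis i 1 $ j * dpart f j x) = dpart f i x"
    by (simp add: axis_def if_distrib[of "\<lambda>x. x * _"] cong: if_cong)
  then show ?thesis
    using line_has_real_derivative[of f x 0 "axis i 1"] assms by simp
qed

lemma C2_on_differentiable:
  assumes "C2_on T u" "x \<in> T"
  shows "u differentiable (at x)" "dpart u i differentiable (at x)"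
  using assms differentiable_on_eq_differentiable_at unfolding C2_on_def by blast+

section \<open>The p-Laplacian in nondivergence form\<close>

lemma norm_grad_powr:
  fixes u :: "real ^ 'n \<Rightarrow> real"
  shows "norm (grad u y) powr a = (\<Sum>j\<in>UNIV. (dpart u j y)\<^sup>2) powr (a/2)"
proof -
  have "norm (grad u y) = (\<Sum>j\<in>UNIV. (dpart u j y)\<^sup>2) powr (1/2)"
    by (simp add: norm_vec_def L2_set_def grad_def powr_half_sqrt sum_nonneg)
  then show ?thesis by (simp add: powr_powr)
qed

text \<open>The case distinction in \<open>pflux\<close> disappears: where the gradient vanishes, so
  does the factor \<open>dpart u i y\<close>. Writing the norm through a sum of squares makes the
  flux easy to differentiate.\<close>

lemma pflux_nth:
  fixes u :: "real ^ 'n \<Rightarrow> real"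
  shows "pflux p u y $ i = (\<Sum>j\<in>UNIV. (dpart u j y)\<^sup>2) powr ((p - 2)/2) * dpart u i y"
proof -
  have *: "grad u y $ i = dpart u i y" by (simp add: grad_def)
  show ?thesis
    by (cases "grad u y = 0") (use * in \<open>auto simp: pflux_def norm_grad_powr\<close>)
qed

text \<open>Product and chain rule applied to \<open>pflux_nth\<close>; \<open>nz\<close> keeps the
  base of the power positive, where \<open>powr\<close> is differentiable.\<close>

lemma plap_eq:
  fixes u :: "real ^ 'n \<Rightarrow> real"
  assumes C: "C2_on T u" "x \<in> T" and nz: "grad u x \<noteq> 0"
  shows "plap p u x = norm (grad u x) powr (p - 2) * (\<Sum>i\<in>UNIV. dpart (dpart u i) i x)
    + (p - 2) * norm (grad u x) powr (p - 4) *
      (\<Sum>i\<in>UNIV. \<Sum>j\<in>UNIV. dpart u i x * dpart u j x * dpart (dpart u i) j x)"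
proof -
  define S where "S y = (\<Sum>j\<in>UNIV. (dpart u j y)\<^sup>2)" for y
  have "S x = (norm (grad u x))\<^sup>2"
    by (simp add: S_def norm_vec_def L2_set_def grad_def sum_nonneg)
  with nz have S0: "S x > 0" by simp
  have pf: "pflux p u y $ i = S y powr ((p-2)/2) * dpart u i y" for y i
    unfolding S_def by (rule pflux_nth)
  have D: "((\<lambda>t. dpart u j (x + t *\<^sub>R axis i 1)) has_real_derivative dpart (dpart u j) i x) (at 0)" for i j
    by (rule dpart_has_real_derivative) (rule C2_on_differentiable[OF C])
  have DS: "((\<lambda>t. S (x + t *\<^sub>R axis i 1)) has_real_derivative
      (\<Sum>j\<in>UNIV. 2 * dpart u j x * dpart (dpart u j) i x)) (at 0)" for i
    unfolding S_def by (rule derivative_eq_intros D | simp add: mult_ac)+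
  have P: "((\<lambda>t. S (x + t *\<^sub>R axis i 1) powr ((p-2)/2)) has_real_derivative
      (p-2)/2 * S x powr ((p-2)/2 - 1) * (\<Sum>j\<in>UNIV. 2 * dpart u j x * dpart (dpart u j) i x)) (at 0)" for i
    using DERIV_fun_powr[OF DS, where r = "(p-2)/2"] S0 by simp
  have F: "dpart (\<lambda>y. pflux p u y $ i) i x =
     S x powr ((p-2)/2) * dpart (dpart u i) i x + (p-2) * S x powr ((p-4)/2) *
       (\<Sum>j\<in>UNIV. dpart u i x * dpart u j x * dpart (dpart u j) i x)" for i
  proof -
    have e: "(p-2)/2 - 1 = (p-4)/2" by (simp add: field_simps)
    have s: "(\<Sum>j\<in>UNIV. 2 * dpart u j x * dpart (dpart u j) i x) * dpart u i x
       = 2 * (\<Sum>j\<in>UNIV. dpart u i x * dpart u j x * dpart (dpart u j) i x)"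
      by (simp add: sum_distrib_left sum_distrib_right mult_ac)
    have "((\<lambda>t. pflux p u (x + t *\<^sub>R axis i 1) $ i) has_real_derivative
       (p-2)/2 * S x powr ((p-2)/2 - 1) * (\<Sum>j\<in>UNIV. 2 * dpart u j x * dpart (dpart u j) i x) * dpart u i x
       + dpart (dpart u i) i x * S x powr ((p-2)/2)) (at 0)"
      unfolding pf using DERIV_mult[OF P D, of i i] by simp
    then have "dpart (\<lambda>y. pflux p u y $ i) i x = (p-2)/2 * S x powr ((p-2)/2 - 1) * ((\<Sum>j\<in>UNIV. 2 * dpart u j x * dpart (dpart u j) i x) * dpart u i x)
       + dpart (dpart u i) i x * S x powr ((p-2)/2)"
      unfolding dpart_def[of "\<lambda>y. pflux p u y $ i"] by (subst DERIV_imp_deriv) (auto simp: mult_ac)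
    then show ?thesis unfolding s e by (simp add: field_simps)
  qed
  \<comment> \<open>Renaming the summation indices takes the place of the symmetry of second
    derivatives.\<close>
  have sw: "(\<Sum>i\<in>UNIV. \<Sum>j\<in>UNIV. dpart u i x * dpart u j x * dpart (dpart u j) i x)
    = (\<Sum>i\<in>UNIV. \<Sum>j\<in>UNIV. dpart u i x * dpart u j x * dpart (dpart u i) j x)"
    by (subst sum.swap) (simp add: mult_ac)
  show ?thesis
    unfolding plap_def F sum.distrib sum_distrib_left[symmetric] sw norm_grad_powr S_def[symmetric] ..
qed

section \<open>Radial functions touching from below\<close>

text \<open>If \<open>f2\<close> were negative, \<open>f1\<close> would be negative just to the
  right of its zero at 0, and \<open>f\<close> would fall below \<open>f 0\<close>.\<close>

lemma second_derivative_test: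
  fixes f f1 :: "real \<Rightarrow> real"
  assumes ev: "\<forall>\<^sub>F t in nhds 0. (f has_real_derivative f1 t) (at t)"
    and D2: "(f1 has_real_derivative f2) (at 0)"
    and min: "\<forall>\<^sub>F t in nhds 0. f 0 \<le> f t"
  shows "f1 0 = 0" "f2 \<ge> 0"
proof -
  obtain d where d: "d > 0" "\<And>t. \<bar>t\<bar> < d \<Longrightarrow> (f has_real_derivative f1 t) (at t)" "\<And>t. \<bar>t\<bar> < d \<Longrightarrow> f 0 \<le> f t"
    using eventually_conj[OF ev min] unfolding eventually_nhds_metric dist_real_def by auto
  show z: "f1 0 = 0"
    by (rule DERIV_local_min[of f _ 0 d]) (use d in auto)
  show "f2 \<ge> 0"
  proof (rule ccontr)
    assume "\<not> f2 \<ge> 0"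
    then obtain e where e: "e > 0" "\<And>h. 0 < h \<Longrightarrow> h < e \<Longrightarrow> f1 h < 0"
      using DERIV_neg_dec_right[OF D2] z by auto
    define t where "t = min d e / 2"
    have t: "0 < t" "t < d" "t < e" using d(1) e(1) by (auto simp: t_def)
    have "f t < f 0"
    proof (rule DERIV_neg_imp_decreasing_open[of 0 t f])
      show "continuous_on {0..t} f"
        by (rule DERIV_continuous_on, rule DERIV_subset, rule d(2)) (use t in auto)
      show "\<exists>y. (f has_real_derivative y) (at x) \<and> y < 0" if "0 < x" "x < t" for x
        using d(2)[of x] e(2)[of x] that t by auto
    qed (use t in auto)
    with d(3)[of t] t show False by auto
  qed
qed

lemma norm_line_has_real_derivative:
  fixes x e :: "'a :: real_inner"
  assumes "x + t *\<^sub>R e \<noteq> 0"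
  shows "((\<lambda>t. norm (x + t *\<^sub>R e)) has_real_derivative
    (x + t *\<^sub>R e) \<bullet> e / norm (x + t *\<^sub>R e)) (at t)"
proof -
  have "((\<lambda>t. norm (x + t *\<^sub>R e)) has_derivative (\<lambda>s. (s *\<^sub>R e) \<bullet> sgn (x + t *\<^sub>R e))) (at t)"
    by (rule has_derivative_compose[where g = norm, of "\<lambda>t. x + t *\<^sub>R e"])
       (auto intro!: derivative_eq_intros has_derivative_norm[OF assms])
  then show ?thesis
    unfolding has_field_derivative_def
    by (rule has_derivative_eq_rhs) (simp add: fun_eq_iff sgn_div_norm inner_commute divide_inverse mult_ac)
qed

text \<open>The second formula is the Hessian of a radial function: \<open>\<phi>2\<close> acts on
  the radial component of \<open>e\<close>, and \<open>\<phi>1 / r\<close> with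
  \<open>r = norm x0\<close> on the tangential one.\<close>

lemma radial_line_derivatives:
  fixes x0 e :: "'a :: real_inner"
  assumes x0: "x0 \<noteq> 0"
    and D1: "\<forall>\<^sub>F r in nhds (norm x0). (\<phi> has_real_derivative \<phi>1 r) (at r)"
    and D2: "(\<phi>1 has_real_derivative \<phi>2) (at (norm x0))"
  shows "\<forall>\<^sub>F t in nhds 0. ((\<lambda>t. \<phi> (norm (x0 + t *\<^sub>R e))) has_real_derivative
      \<phi>1 (norm (x0 + t *\<^sub>R e)) * ((x0 + t *\<^sub>R e) \<bullet> e / norm (x0 + t *\<^sub>R e))) (at t)"
    and "((\<lambda>t. \<phi>1 (norm (x0 + t *\<^sub>R e)) * ((x0 + t *\<^sub>R e) \<bullet> e / norm (x0 + t *\<^sub>R e)))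
      has_real_derivative
      \<phi>2 * (x0 \<bullet> e / norm x0)\<^sup>2 + \<phi>1 (norm x0) * (e \<bullet> e / norm x0 - (x0 \<bullet> e)\<^sup>2 / norm x0 ^ 3)) (at 0)"
proof -
  have "((\<lambda>t. norm (x0 + t *\<^sub>R e)) \<longlongrightarrow> norm x0) (at 0)"
    by (auto intro!: tendsto_eq_intros)
  then have lim: "filterlim (\<lambda>t. norm (x0 + t *\<^sub>R e)) (nhds (norm x0)) (nhds 0)"
    using filterlim_at_within_not_equal by (auto simp: tendsto_nhds_iff)
  have "\<forall>\<^sub>F t in nhds 0. norm (x0 + t *\<^sub>R e) \<in> {0<..}"
    by (rule topological_tendstoD[OF lim]) (use x0 in auto)
  then show "\<forall>\<^sub>F t in nhds 0. ((\<lambda>t. \<phi> (norm (x0 + t *\<^sub>R e))) has_real_derivative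
      \<phi>1 (norm (x0 + t *\<^sub>R e)) * ((x0 + t *\<^sub>R e) \<bullet> e / norm (x0 + t *\<^sub>R e))) (at t)"
    using eventually_compose_filterlim[OF D1 lim]
  proof eventually_elim
    case (elim t)
    then have "x0 + t *\<^sub>R e \<noteq> 0" by auto
    from DERIV_chain2[OF elim(2) norm_line_has_real_derivative[OF this]] show ?case .
  qed
  have n: "((\<lambda>t. norm (x0 + t *\<^sub>R e)) has_real_derivative (x0 \<bullet> e / norm x0)) (at 0)"
    using norm_line_has_real_derivative[of x0 0 e] x0 by simp
  have i: "((\<lambda>t. (x0 + t *\<^sub>R e) \<bullet> e) has_real_derivative e \<bullet> e) (at 0)"
    by (auto simp: inner_add_left intro!: derivative_eq_intros)
  have p: "((\<lambda>t. \<phi>1 (norm (x0 + t *\<^sub>R e))) has_real_derivative \<phi>2 * (x0 \<bullet> e / norm x0)) (at 0)"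
    by (rule DERIV_chain2[where f = \<phi>1, OF _ n]) (use D2 in simp)
  have q: "((\<lambda>t. (x0 + t *\<^sub>R e) \<bullet> e / norm (x0 + t *\<^sub>R e)) has_real_derivative
      (e \<bullet> e / norm x0 - (x0 \<bullet> e)\<^sup>2 / norm x0 ^ 3)) (at 0)"
    using DERIV_divide[OF i n] x0 by (simp add: field_simps power2_eq_square power3_eq_cube)
  show "((\<lambda>t. \<phi>1 (norm (x0 + t *\<^sub>R e)) * ((x0 + t *\<^sub>R e) \<bullet> e / norm (x0 + t *\<^sub>R e)))
      has_real_derivative
      \<phi>2 * (x0 \<bullet> e / norm x0)\<^sup>2 + \<phi>1 (norm x0) * (e \<bullet> e / norm x0 - (x0 \<bullet> e)\<^sup>2 / norm x0 ^ 3)) (at 0)"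
    using DERIV_mult[OF p q] by (simp add: power2_eq_square algebra_simps)
qed

text \<open>At the touching point the difference of \<open>w\<close> and the radial function has a
  local minimum, so the gradients agree and the Hessian of \<open>w\<close> dominates. In
  nondivergence form the trace and the second derivative along the gradient, which is radial here,
  enter with nonnegative weights since \<open>p \<ge> 2\<close>, so it suffices to bound them
  separately.\<close>

lemma plap_ge_radial:
  fixes w :: "real ^ 'n \<Rightarrow> real"
  assumes C: "C2_on T w" "x0 \<in> T" and x0: "x0 \<noteq> 0" and p: "p \<ge> 2"
    and D1: "\<forall>\<^sub>F r in nhds (norm x0). (\<phi> has_real_derivative \<phi>1 r) (at r)"
    and D2: "(\<phi>1 has_real_derivative \<phi>2) (at (norm x0))"
    and neg: "\<phi>1 (norm x0) < 0"
    and below: "\<forall>\<^sub>F x in nhds x0. \<phi> (norm x) \<le> w x"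
    and touch: "\<phi> (norm x0) = w x0"
  shows "plap p w x0 \<ge> \<bar>\<phi>1 (norm x0)\<bar> powr (p - 2) *
    ((p - 1) * \<phi>2 + (real CARD('n) - 1) * \<phi>1 (norm x0) / norm x0)"
proof -
  define r where "r = norm x0"
  have r: "r > 0" using x0 by (simp add: r_def)
  have rr: "(\<Sum>i\<in>UNIV. (x0 $ i)\<^sup>2) = r\<^sup>2"
    by (simp add: r_def norm_vec_def L2_set_def sum_nonneg)
  define A where "A i j = dpart (dpart w i) j x0" for i j
  have T: "open T" using C(1) by (simp add: C2_on_def)
  \<comment> \<open>\<open>e\<close> stays free: the axes give the gradient and the trace, the
    direction \<open>x0 /\<^sub>R r\<close> gives the quadratic form.\<close>
  have test: "(\<Sum>i\<in>UNIV. e $ i * dpart w i x0) = \<phi>1 r * (x0 \<bullet> e / r)"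
    "(\<Sum>i\<in>UNIV. e $ i * (\<Sum>j\<in>UNIV. e $ j * A i j)) \<ge>
      \<phi>2 * (x0 \<bullet> e / r)\<^sup>2 + \<phi>1 r * (e \<bullet> e / r - (x0 \<bullet> e)\<^sup>2 / r ^ 3)" for e :: "real ^ 'n"
  proof -
    define f where "f t = w (x0 + t *\<^sub>R e) - \<phi> (norm (x0 + t *\<^sub>R e))" for t
    define f1 where "f1 t = (\<Sum>i\<in>UNIV. e $ i * dpart w i (x0 + t *\<^sub>R e)) -
      \<phi>1 (norm (x0 + t *\<^sub>R e)) * ((x0 + t *\<^sub>R e) \<bullet> e / norm (x0 + t *\<^sub>R e))" for t
    have "((\<lambda>t. x0 + t *\<^sub>R e) \<longlongrightarrow> x0) (at 0)"
      by (auto intro!: tendsto_eq_intros)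
    then have lim: "filterlim (\<lambda>t. x0 + t *\<^sub>R e) (nhds x0) (nhds 0)"
      by (auto simp: tendsto_nhds_iff)
    have "\<forall>\<^sub>F t in nhds 0. x0 + t *\<^sub>R e \<in> T"
      by (rule topological_tendstoD[OF lim]) (use C T in auto)
    then have ev: "\<forall>\<^sub>F t in nhds 0. (f has_real_derivative f1 t) (at t)"
      using radial_line_derivatives(1)[OF x0 D1 D2, of e]
    proof eventually_elim
      case (elim t)
      from DERIV_diff[OF line_has_real_derivative elim(2), OF C2_on_differentiable(1)[OF C(1) elim(1)]]
      show ?case unfolding f_def f1_def .
    qed
    have L: "((\<lambda>t. dpart w i (x0 + t *\<^sub>R e)) has_real_derivative (\<Sum>j\<in>UNIV. e $ j * A i j)) (at 0)" for i
      using line_has_real_derivative[of "dpart w i" x0 0 e] C2_on_differentiable(2)[OF C]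
      by (simp add: A_def)
    have "((\<lambda>t. \<Sum>i\<in>UNIV. e $ i * dpart w i (x0 + t *\<^sub>R e)) has_real_derivative
        (\<Sum>i\<in>UNIV. e $ i * (\<Sum>j\<in>UNIV. e $ j * A i j))) (at 0)"
      by (intro DERIV_sum DERIV_cmult L)
    from DERIV_diff[OF this radial_line_derivatives(2)[OF x0 D1 D2, of e]]
    have f2: "(f1 has_real_derivative (\<Sum>i\<in>UNIV. e $ i * (\<Sum>j\<in>UNIV. e $ j * A i j)) -
        (\<phi>2 * (x0 \<bullet> e / r)\<^sup>2 + \<phi>1 r * (e \<bullet> e / r - (x0 \<bullet> e)\<^sup>2 / r ^ 3))) (at 0)"
      unfolding f1_def r_def .
    have "\<forall>\<^sub>F t in nhds 0. f 0 \<le> f t"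
      using eventually_compose_filterlim[OF below lim] by (simp add: f_def touch)
    from second_derivative_test[OF ev f2 this]
    show "(\<Sum>i\<in>UNIV. e $ i * dpart w i x0) = \<phi>1 r * (x0 \<bullet> e / r)"
      "(\<Sum>i\<in>UNIV. e $ i * (\<Sum>j\<in>UNIV. e $ j * A i j)) \<ge>
      \<phi>2 * (x0 \<bullet> e / r)\<^sup>2 + \<phi>1 r * (e \<bullet> e / r - (x0 \<bullet> e)\<^sup>2 / r ^ 3)"
      by (simp_all add: f1_def r_def)
  qed
  have ax: "(\<Sum>j\<in>UNIV. axis i 1 $ j * h j) = h i" for i :: 'n and h :: "'n \<Rightarrow> real"
    by (simp add: axis_def if_distrib[of "\<lambda>x. x * _"] cong: if_cong)
  have g: "dpart w i x0 = \<phi>1 r / r * x0 $ i" for i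
    using test(1)[of "axis i 1"] by (simp add: ax inner_axis)
  have "grad w x0 = (\<phi>1 r / r) *\<^sub>R x0"
    by (simp add: vec_eq_iff grad_def g)
  then have ng: "norm (grad w x0) = \<bar>\<phi>1 r\<bar>" and nz: "grad w x0 \<noteq> 0"
    using neg r x0 by (auto simp: r_def)
  have "(\<Sum>i\<in>UNIV. A i i) \<ge> (\<Sum>i\<in>UNIV. \<phi>2 * (x0 $ i)\<^sup>2 / r\<^sup>2 + \<phi>1 r * (1 / r - (x0 $ i)\<^sup>2 / r ^ 3))"
  proof (rule sum_mono)
    show "\<phi>2 * (x0 $ i)\<^sup>2 / r\<^sup>2 + \<phi>1 r * (1 / r - (x0 $ i)\<^sup>2 / r ^ 3) \<le> A i i" for i
      using test(2)[of "axis i 1"] by (simp add: ax inner_axis power_divide inner_axis_axis)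
  qed
  also have "(\<Sum>i\<in>UNIV. \<phi>2 * (x0 $ i)\<^sup>2 / r\<^sup>2 + \<phi>1 r * (1 / r - (x0 $ i)\<^sup>2 / r ^ 3))
    = \<phi>2 * r\<^sup>2 / r\<^sup>2 + \<phi>1 r * (real CARD('n) / r - r\<^sup>2 / r ^ 3)"
    unfolding rr[symmetric]
    by (simp add: sum.distrib sum_subtractf sum_distrib_left[symmetric] sum_divide_distrib[symmetric])
  also have "\<dots> = \<phi>2 + (real CARD('n) - 1) * \<phi>1 r / r"
    using r by (simp add: field_simps power2_eq_square power3_eq_cube)
  finally have tr: "(\<Sum>i\<in>UNIV. A i i) \<ge> \<phi>2 + (real CARD('n) - 1) * \<phi>1 r / r" .
  have xx: "x0 \<bullet> x0 = r\<^sup>2" by (simp add: r_def power2_norm_eq_inner)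
  \<comment> \<open>In the radial direction the tangential term cancels, which leaves
    \<open>\<phi>2\<close> alone.\<close>
  have "(\<Sum>i\<in>UNIV. x0 $ i / r * (\<Sum>j\<in>UNIV. x0 $ j / r * A i j)) \<ge> \<phi>2"
    using test(2)[of "x0 /\<^sub>R r"] r xx
    by (simp add: divide_inverse mult_ac power2_eq_square power3_eq_cube)
  then have "\<phi>1 r ^ 2 * (\<Sum>i\<in>UNIV. x0 $ i / r * (\<Sum>j\<in>UNIV. x0 $ j / r * A i j)) \<ge> \<phi>1 r ^ 2 * \<phi>2"
    by (rule mult_left_mono) simp
  also have "\<phi>1 r ^ 2 * (\<Sum>i\<in>UNIV. x0 $ i / r * (\<Sum>j\<in>UNIV. x0 $ j / r * A i j)) =
      (\<Sum>i\<in>UNIV. \<Sum>j\<in>UNIV. dpart w i x0 * dpart w j x0 * A i j)"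
    unfolding g sum_distrib_left by (intro sum.cong refl) (simp add: power2_eq_square)
  finally have q: "(\<Sum>i\<in>UNIV. \<Sum>j\<in>UNIV. dpart w i x0 * dpart w j x0 * A i j) \<ge> \<phi>1 r ^ 2 * \<phi>2" .
  have pw: "\<bar>\<phi>1 r\<bar> powr (p - 4) * \<phi>1 r ^ 2 = \<bar>\<phi>1 r\<bar> powr (p - 2)"
    using powr_add[of "\<bar>\<phi>1 r\<bar>" "p - 4" 2] by simp
  have "plap p w x0 = \<bar>\<phi>1 r\<bar> powr (p - 2) * (\<Sum>i\<in>UNIV. A i i)
    + (p - 2) * \<bar>\<phi>1 r\<bar> powr (p - 4) *
      (\<Sum>i\<in>UNIV. \<Sum>j\<in>UNIV. dpart w i x0 * dpart w j x0 * A i j)"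
    using plap_eq[OF C nz, of p] unfolding ng A_def .
  also have "\<dots> \<ge> \<bar>\<phi>1 r\<bar> powr (p - 2) * (\<phi>2 + (real CARD('n) - 1) * \<phi>1 r / r)
     + (p - 2) * \<bar>\<phi>1 r\<bar> powr (p - 4) * (\<phi>1 r ^ 2 * \<phi>2)"
    by (intro add_mono mult_left_mono tr q) (use p in auto)
  also have "(p - 2) * \<bar>\<phi>1 r\<bar> powr (p - 4) * (\<phi>1 r ^ 2 * \<phi>2) = (p - 2) * \<phi>2 * \<bar>\<phi>1 r\<bar> powr (p - 2)"
    unfolding pw[symmetric] by simp
  finally show ?thesis unfolding r_def by (simp add: algebra_simps)
qed

section \<open>The Riccati inequality at a touching point\<close>

text \<open>This is \<open>F\<close> of the Riccati inequality: \<open>g powr p\<close> comes from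
  the Hardy term, and \<open>p * g\<close> is the dimension minus \<open>p\<close>.\<close>

definition riccati :: "real \<Rightarrow> real \<Rightarrow> real \<Rightarrow> real" where
  "riccati p g h = (p - 1) * h powr p - p * g * h powr (p - 1) + g powr p"

text \<open>With \<open>\<phi>' = - \<phi> h / r\<close> the second derivative is
  \<open>\<phi> (h^2 + h - h') / r^2\<close>. The radial bound and both potential terms then share
  the positive factor \<open>\<phi>^(p-1) / r^p\<close>, which is divided out. The derivative
  \<open>h'\<close> is taken in the variable \<open>ln r\<close>.\<close>

lemma riccati_of_touching:
  fixes w :: "real ^ 'n \<Rightarrow> real" and p g eps :: real
  assumes p: "p \<ge> 2" and g: "g = (real CARD('n) - p) / p"
    and C: "C2_on T w" "x0 \<in> T" and x0: "norm x0 > 1"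
    and super: "hardy_op p (g powr p) eps w x0 \<ge> 0"
    and D: "\<forall>\<^sub>F r in nhds (norm x0). (\<phi> has_real_derivative - \<phi> r * h (ln r) / r) (at r)"
    and Dh: "(h has_real_derivative h') (at (ln (norm x0)))"
    and hpos: "h (ln (norm x0)) > 0" and pos: "w x0 > 0"
    and below: "\<forall>\<^sub>F x in nhds x0. \<phi> (norm x) \<le> w x"
    and touch: "\<phi> (norm x0) = w x0"
  shows "riccati p g (h (ln (norm x0))) + eps / (ln (norm x0))\<^sup>2
    \<le> (p - 1) * h (ln (norm x0)) powr (p - 2) * h'"
proof -
  define r where "r = norm x0"
  define H where "H = h (ln r)"
  define F where "F = \<phi> r"
  define \<phi>1 where "\<phi>1 r = - \<phi> r * h (ln r) / r" for r
  have r: "r > 1" using x0 by (simp add: r_def)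
  have H: "H > 0" using hpos by (simp add: H_def r_def)
  have F: "F > 0" using pos touch by (simp add: F_def r_def)
  \<comment> \<open>Expressing the dimension by \<open>g\<close> lets the terms
    \<open>(p - 1) * H\<close> cancel below, leaving \<open>- p * g * H\<close>.\<close>
  have N: "real CARD('n) = p * g + p" using g p by (simp add: field_simps)
  have D0: "(\<phi> has_real_derivative - F * H / r) (at r)"
    using eventually_nhds_x_imp_x[OF D] unfolding F_def H_def r_def .
  have Dh': "((\<lambda>r. h (ln r)) has_real_derivative h' * (1 / r)) (at r)"
    by (rule DERIV_chain2[where f = h and g = ln, OF Dh[folded r_def]]) (use r in \<open>auto intro!: derivative_eq_intros\<close>)
  have D2: "(\<phi>1 has_real_derivative F / r\<^sup>2 * (H\<^sup>2 + H - h')) (at r)"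
  proof -
    have "((\<lambda>r. - \<phi> r * h (ln r) / r) has_real_derivative
      (((- (- F * H / r)) * h (ln r) + (h' * (1/r)) * - \<phi> r) * r - (- \<phi> r * h (ln r)) * 1) / (r * r)) (at r)"
      by (rule DERIV_divide DERIV_mult DERIV_minus D0 Dh' DERIV_ident)+ (use r in auto)
    then show ?thesis unfolding \<phi>1_def F_def[symmetric] H_def[symmetric]
      by (rule DERIV_cong) (use r in \<open>simp add: field_simps power2_eq_square\<close>)
  qed
  have p1: "\<phi>1 r = - (F * H / r)" by (simp add: \<phi>1_def F_def H_def)
  have ab: "\<bar>\<phi>1 r\<bar> = F * H / r" using F H r by (simp add: p1)
  have "plap p w x0 \<ge> \<bar>\<phi>1 r\<bar> powr (p - 2) *
    ((p - 1) * (F / r\<^sup>2 * (H\<^sup>2 + H - h')) + (real CARD('n) - 1) * \<phi>1 r / r)"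
    unfolding r_def
  proof (rule plap_ge_radial[OF C _ p _ _ _ below touch])
    show "\<forall>\<^sub>F r in nhds (norm x0). (\<phi> has_real_derivative \<phi>1 r) (at r)"
      using D by (simp add: \<phi>1_def)
    show "\<phi>1 (norm x0) < 0"
      unfolding r_def[symmetric] p1 using F H r by simp
  qed (use D2 x0 in \<open>auto simp: r_def\<close>)
  also have "\<bar>\<phi>1 r\<bar> powr (p - 2) = F powr (p - 2) * H powr (p - 2) / r powr (p - 2)"
    unfolding ab using F H r by (simp add: powr_divide powr_mult)
  also have "F powr (p - 2) * H powr (p - 2) / r powr (p - 2) *
      ((p - 1) * (F / r\<^sup>2 * (H\<^sup>2 + H - h')) + (real CARD('n) - 1) * \<phi>1 r / r)
    = (F powr (p - 2) * F / (r powr (p - 2) * r\<^sup>2)) *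
      (H powr (p - 2) * ((p - 1) * (H\<^sup>2 - h') - p * g * H))"
    using r unfolding p1 N by (simp add: field_simps power2_eq_square)
  also have "r powr (p - 2) * r\<^sup>2 = r powr p"
    using r powr_add[of r "p - 2" 2] by simp
  finally have A: "plap p w x0 \<ge> (F powr (p - 2) * F / r powr p) *
      (H powr (p - 2) * ((p - 1) * (H\<^sup>2 - h') - p * g * H))" .
  have "0 \<le> - plap p w x0 - g powr p / r powr p * (F powr (p - 2) * F)
      - eps / (r powr p * (ln r)\<^sup>2) * (F powr (p - 2) * F)"
    using super pos touch unfolding hardy_op_def r_def[symmetric] F_def by simp
  also have "\<dots> = - plap p w x0 - (F powr (p - 2) * F / r powr p) * (g powr p + eps / (ln r)\<^sup>2)"
    by (simp add: distrib_left add_divide_distrib mult_ac)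
  finally have "0 \<le> - plap p w x0 - (F powr (p - 2) * F / r powr p) * (g powr p + eps / (ln r)\<^sup>2)" .
  with A have "0 \<le> (F powr (p - 2) * F / r powr p) * (- (H powr (p - 2) * ((p - 1) * (H\<^sup>2 - h') - p * g * H))
     - (g powr p + eps / (ln r)\<^sup>2))"
    unfolding right_diff_distrib mult_minus_right by linarith
  moreover have "F powr (p - 2) * F / r powr p > 0" using F r by simp
  ultimately have "0 \<le> - (H powr (p - 2) * ((p - 1) * (H\<^sup>2 - h') - p * g * H))
     - (g powr p + eps / (ln r)\<^sup>2)"
    by (metis mult_pos_neg not_le)
  moreover have "H powr p = H powr (p - 2) * H\<^sup>2" "H powr (p - 1) = H powr (p - 2) * H"
    using H powr_add[of H "p - 2" 2] powr_add[of H "p - 2" 1] by simp_all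
  ultimately show ?thesis
    unfolding riccati_def r_def[symmetric] H_def[symmetric] by (simp add: algebra_simps)
qed

section \<open>Lower bounds for the Riccati function\<close>

lemma riccati_split:
  assumes "h > 0"
  shows "riccati p g h = h powr (p - 2) * ((p - 1) * h\<^sup>2 - p * g * h) + g powr p"
proof -
  have "h powr p = h powr (p - 2) * h\<^sup>2" "h powr (p - 1) = h powr (p - 2) * h"
    using assms powr_add[of h "p - 2" 2] powr_add[of h "p - 2" 1] by simp_all
  then show ?thesis by (simp add: riccati_def algebra_simps)
qed

text \<open>Bernoulli's inequality for real exponents: \<open>x powr a - a * x\<close> decreases up
  to 1 and increases after it.\<close>

lemma bernoulli_powr:
  fixes x a :: real
  assumes "x > 0" "a \<ge> 1"
  shows "1 + a * (x - 1) \<le> x powr a"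
proof -
  define f where "f x = x powr a - a * x" for x :: real
  have D: "(f has_real_derivative a * (y powr (a - 1) - 1)) (at y)" if "y > 0" for y
    unfolding f_def using that by (auto intro!: derivative_eq_intros simp: algebra_simps)
  have "f 1 \<le> f x"
  proof (cases "x \<le> 1")
    case True
    then show ?thesis
    proof (rule DERIV_nonpos_imp_nonincreasing)
      fix y assume y: "x \<le> y" "y \<le> 1"
      then have "a * (y powr (a - 1) - 1) \<le> 0"
        using assms by (intro mult_nonneg_nonpos) (auto intro!: powr_le1)
      with D[of y] show "\<exists>z. (f has_real_derivative z) (at y) \<and> z \<le> 0"
        using y assms by auto
    qed
  next
    case False
    then have "1 \<le> x" by simp
    then show ?thesis
    proof (rule DERIV_nonneg_imp_nondecreasing)
      fix y assume y: "1 \<le> y" "y \<le> x"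
      then have "a * (y powr (a - 1) - 1) \<ge> 0"
        using assms by (intro mult_nonneg_nonneg) (auto intro!: ge_one_powr_ge_zero)
      with D[of y] show "\<exists>z. (f has_real_derivative z) (at y) \<and> z \<ge> 0"
        using y assms by auto
    qed
  qed
  then show ?thesis by (simp add: f_def algebra_simps)
qed

text \<open>The derivative of \<open>riccati p g\<close> at \<open>u\<close> is
  \<open>p * (p - 1) * u powr (p - 2) * (u - g)\<close>. Bounding the power below by
  \<open>m powr (p - 2)\<close> shows that the difference \<open>G\<close> decreases up to
  \<open>g\<close> and increases after it, while \<open>G g = 0\<close>. Below \<open>g\<close> the
  lemma is used with \<open>m = h\<close>, above it with \<open>m = g\<close>.\<close>

lemma riccati_ge_quadratic:
  assumes p: "p \<ge> 2" and m: "0 < m" "m \<le> g" "m \<le> h"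
  shows "riccati p g h \<ge> p * (p - 1) / 2 * m powr (p - 2) * (h - g)\<^sup>2"
proof -
  define G where "G u = riccati p g u - p * (p - 1) / 2 * m powr (p - 2) * (u - g)\<^sup>2" for u
  have D: "(G has_real_derivative p * (p - 1) * (u powr (p - 2) - m powr (p - 2)) * (u - g)) (at u)"
    if u: "u > 0" for u
  proof -
    have "u powr (p - 1) = u powr (p - 2) * u" using u powr_add[of u "p - 2" 1] by simp
    moreover have "(G has_real_derivative (p - 1) * (p * u powr (p - 1)) - p * g * ((p - 1) * u powr (p - 2))
        - p * (p - 1) / 2 * m powr (p - 2) * (2 * (u - g))) (at u)"
      unfolding G_def riccati_def using u
      by (auto intro!: derivative_eq_intros simp: field_simps)
    ultimately show ?thesis by (simp add: algebra_simps add_divide_distrib diff_divide_distrib)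
  qed
  have mono: "m powr (p - 2) \<le> u powr (p - 2)" if "m \<le> u" for u
    using that m p by (intro powr_mono2) auto
  have "G g \<le> G h"
  proof (cases "h \<le> g")
    case True
    then show ?thesis
    proof (rule DERIV_nonpos_imp_nonincreasing)
      fix u assume u: "h \<le> u" "u \<le> g"
      have "p * (p - 1) * (u powr (p - 2) - m powr (p - 2)) * (u - g) \<le> 0"
        by (intro mult_nonneg_nonpos mult_nonneg_nonneg) (use u m p mono[of u] in auto)
      with D[of u] show "\<exists>y. (G has_real_derivative y) (at u) \<and> y \<le> 0" using u m by auto
    qed
  next
    case False
    then have "g \<le> h" by simp
    then show ?thesis
    proof (rule DERIV_nonneg_imp_nondecreasing)
      fix u assume u: "g \<le> u" "u \<le> h"
      have "p * (p - 1) * (u powr (p - 2) - m powr (p - 2)) * (u - g) \<ge> 0"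
        by (intro mult_nonneg_nonneg) (use u m p mono[of u] in auto)
      with D[of u] show "\<exists>y. (G has_real_derivative y) (at u) \<and> y \<ge> 0" using u m by auto
    qed
  qed
  moreover have "G g = 0"
    using m riccati_split[of g p g] powr_add[of g "p - 2" 2] by (simp add: G_def algebra_simps power2_eq_square)
  ultimately show ?thesis by (simp add: G_def)
qed

text \<open>Bernoulli's inequality at \<open>g / h\<close> bounds \<open>g powr p\<close> from
  below. The constant is 1 instead of \<open>p / 2\<close>, but the weight
  \<open>h powr (p - 2)\<close> is available on both sides of \<open>g\<close> and cancels against
  the same weight in front of \<open>h'\<close> in the Riccati inequality.\<close>

lemma riccati_ge_square:
  assumes p: "p \<ge> 2" and g: "g > 0" and h: "h > 0"
  shows "riccati p g h \<ge> (p - 1) * h powr (p - 2) * (h - g)\<^sup>2"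
proof -
  have "1 + (p - 1) * (g / h - 1) \<le> (g / h) powr (p - 1)"
    by (rule bernoulli_powr) (use assms in auto)
  then have "h powr (p - 1) * (1 + (p - 1) * (g / h - 1)) \<le> g powr (p - 1)"
    using g h by (simp add: powr_divide field_simps)
  moreover have e: "h powr (p - 1) = h powr (p - 2) * h" "g powr p = g powr (p - 1) * g"
    using h g powr_add[of h "p - 2" 1] powr_add[of g "p - 1" 1] by simp_all
  moreover have "h * (1 + (p - 1) * (g / h - 1)) = (p - 1) * g - (p - 2) * h"
    using h by (simp add: field_simps)
  ultimately have "h powr (p - 2) * ((p - 1) * g - (p - 2) * h) \<le> g powr (p - 1)"
    by (simp add: mult.assoc)
  then have "h powr (p - 2) * ((p - 1) * g - (p - 2) * h) * g \<le> g powr (p - 1) * g"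
    using g by (intro mult_right_mono) auto
  then show ?thesis
    unfolding riccati_split[OF h] e(2)[symmetric] by (simp add: algebra_simps power2_eq_square)
qed

section \<open>Strict subsolutions\<close>

text \<open>
  Here \<open>h = - r \<phi>' / \<phi>\<close> for \<open>\<phi>(r) = r^(-g) s^beta t^(-sigma) (T - t)^2\<close>, with \<open>D = 2 / (T - t)\<close> and hence
  \<open>dD/dt = D^2 / 2\<close>. The cutoff is squared because \<open>T - t\<close> itself would give \<open>dD/dt = D^2\<close>, which leaves
  no room against \<open>(h - g)^2 s^2\<close> as \<open>D\<close> tends to infinity.
\<close>

lemma strict_subsolution:
  fixes p g beta betab sigma s t D :: real
  defines "b \<equiv> beta - sigma / t - D"
  defines "et \<equiv> p / 2 * (beta * betab)"
  defines "h \<equiv> g - b / s"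
  assumes p: "p \<ge> 2" and g: "g > 0" and beta: "0 < beta" "beta \<le> betab"
    and sum: "p / 2 * (beta + betab) = 1" and sigma: "sigma > 0" and t: "t > 0" and s: "s > 0"
    and D: "D \<ge> 0" and s1: "beta < g * s"
    and s2: "(p - 1) * beta / (g * s) * (p / 2 * beta\<^sup>2 + et) < sigma / t\<^sup>2"
  shows "h > 0"
    "(p - 1) * h powr (p - 2) * ((b - sigma / t\<^sup>2 + D\<^sup>2 / 2) / s\<^sup>2)
      < riccati p g h + (p - 1) * g powr (p - 2) * et / s\<^sup>2"
proof -
  have st: "sigma / t\<^sup>2 > 0" "sigma / t > 0" using sigma t by simp_all
  have et: "et > 0" using p beta by (simp add: et_def)
  have "b \<le> beta" using st D by (simp add: b_def)
  then have "b / s \<le> beta / s" using s by (simp add: divide_right_mono)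
  also have "beta / s < g" using s1 s by (simp add: field_simps)
  finally show h: "h > 0" by (simp add: h_def)
  have hg: "(h - g)\<^sup>2 = b\<^sup>2 / s\<^sup>2" by (simp add: h_def power_divide)
  \<comment> \<open>\<open>b\<close> lies below both roots of \<open>p / 2 * b^2 - b + et\<close> by
    at least \<open>D\<close>, and \<open>p / 2 \<ge> 1\<close>.\<close>
  have Q: "p / 2 * b\<^sup>2 + et - b \<ge> D\<^sup>2"
  proof -
    have "p / 2 * b\<^sup>2 + et - (p / 2 * (beta + betab)) * b = p / 2 * ((b - beta) * (b - betab))"
      by (simp add: et_def algebra_simps power2_eq_square)
    then have "p / 2 * b\<^sup>2 + et - b = p / 2 * ((b - beta) * (b - betab))" unfolding sum by simp
    also have "(b - beta) * (b - betab) = (D + sigma / t) * (D + sigma / t + (betab - beta))"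
      by (simp add: b_def algebra_simps)
    also have "p / 2 * \<dots> \<ge> 1 * (D * D)"
      by (intro mult_mono) (use p D st beta in auto)
    finally show ?thesis by (simp add: power2_eq_square)
  qed
  define M where "M = (p - 1) * h powr (p - 2)"
  have M: "M > 0" using p h by (simp add: M_def)
  have D2: "D\<^sup>2 \<ge> 0" by simp
  have key: "M * ((b - sigma / t\<^sup>2 + D\<^sup>2 / 2) / s\<^sup>2) < X" if "M * (Y / s\<^sup>2) \<le> X" "Y > b - sigma / t\<^sup>2 + D\<^sup>2 / 2" for X Y
  proof -
    have "M * ((b - sigma / t\<^sup>2 + D\<^sup>2 / 2) / s\<^sup>2) < M * (Y / s\<^sup>2)"
      using that(2) M s by (intro mult_strict_left_mono divide_strict_right_mono) auto
    with that(1) show ?thesis by linarith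
  qed
  \<comment> \<open>For \<open>b > 0\<close>, \<open>h\<close> is below \<open>g\<close> and its
    weight is the smaller one. For \<open>b \<le> - beta\<close> the term
    \<open>b^2 = s^2 (h - g)^2\<close> alone outweighs \<open>b + D^2 / 2\<close>. In between
    \<open>b\<close> is bounded, and passing from the weight at \<open>g\<close> to that at
    \<open>h\<close> costs a factor \<open>1 - O(1 / s)\<close>, which \<open>s2\<close>
    absorbs.\<close>
  consider "b > 0" | "b \<le> - beta" | "- beta < b" "b \<le> 0" by linarith
  then show "(p - 1) * h powr (p - 2) * ((b - sigma / t\<^sup>2 + D\<^sup>2 / 2) / s\<^sup>2)
      < riccati p g h + (p - 1) * g powr (p - 2) * et / s\<^sup>2"
    unfolding M_def[symmetric]
  proof cases
    case 1
    have "h \<le> g" using 1 s by (simp add: h_def)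
    have "riccati p g h \<ge> M * (p / 2 * b\<^sup>2) / s\<^sup>2"
      using riccati_ge_quadratic[OF p h \<open>h \<le> g\<close> order_refl] by (simp add: hg M_def mult_ac)
    moreover have "M * et / s\<^sup>2 \<le> (p - 1) * g powr (p - 2) * et / s\<^sup>2"
      unfolding M_def using p h \<open>h \<le> g\<close> et
      by (intro divide_right_mono mult_right_mono mult_left_mono powr_mono2) auto
    ultimately have "M * ((p / 2 * b\<^sup>2 + et) / s\<^sup>2) \<le> riccati p g h + (p - 1) * g powr (p - 2) * et / s\<^sup>2"
      by (simp add: algebra_simps add_divide_distrib)
    then show "M * ((b - sigma / t\<^sup>2 + D\<^sup>2 / 2) / s\<^sup>2) < riccati p g h + (p - 1) * g powr (p - 2) * et / s\<^sup>2"
      by (rule key) (use Q st D2 in linarith)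
  next
    case 2
    have "M * (b\<^sup>2 / s\<^sup>2) \<le> riccati p g h"
      using riccati_ge_square[OF p g h] by (simp add: hg M_def)
    moreover have "(p - 1) * g powr (p - 2) * et / s\<^sup>2 \<ge> 0" using p et by simp
    ultimately have "M * (b\<^sup>2 / s\<^sup>2) \<le> riccati p g h + (p - 1) * g powr (p - 2) * et / s\<^sup>2" by linarith
    then show "M * ((b - sigma / t\<^sup>2 + D\<^sup>2 / 2) / s\<^sup>2) < riccati p g h + (p - 1) * g powr (p - 2) * et / s\<^sup>2"
    proof (rule key)
      have "p / 2 * (beta + beta) \<le> p / 2 * (beta + betab)" using p beta by (intro mult_left_mono) auto
      then have "p * beta \<le> 1" unfolding sum by simp
      moreover have "2 * beta \<le> p * beta" using p beta by (intro mult_right_mono) auto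
      ultimately have b1: "beta \<le> 1" using beta by linarith
      have b0: "b \<le> 0" using 2 beta by simp
      \<comment> \<open>Here the factor 1/2 from the squared cutoff counts:
        \<open>D^2 / 2 \<le> b^2 - b\<close> follows from \<open>D \<le> beta - b\<close>,
        \<open>beta \<le> 1\<close> and \<open>beta \<le> - b\<close>.\<close>
      have "D \<le> beta - b" using st by (simp add: b_def)
      then have "D\<^sup>2 \<le> (beta - b)\<^sup>2" using D by (intro power_mono) auto
      also have "\<dots> = beta\<^sup>2 + 2 * (beta * (-b)) + b\<^sup>2" by (simp add: power2_eq_square algebra_simps)
      also have "\<dots> \<le> b\<^sup>2 + 2 * (-b) + b\<^sup>2"
      proof -
        have "beta * (-b) \<le> 1 * (-b)" using b1 b0 by (intro mult_right_mono) auto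
        moreover have "beta\<^sup>2 \<le> (-b)\<^sup>2" using 2 beta by (intro power_mono) auto
        ultimately show ?thesis by simp
      qed
      finally show "b - sigma / t\<^sup>2 + D\<^sup>2 / 2 < b\<^sup>2" using st by simp
    qed
  next
    case 3
    define th where "th = (g / h) powr (p - 2)"
    have gh: "g \<le> h" using 3 s by (simp add: h_def divide_nonpos_pos)
    have Mth: "M * th = (p - 1) * g powr (p - 2)"
      using g h by (simp add: M_def th_def powr_divide)
    \<comment> \<open>Bernoulli's inequality needs an exponent of at least 1. The base is at most 1,
      so raising the exponent to \<open>p - 1\<close> only lowers the power.\<close>
    have "th \<ge> (g / h) powr (p - 1)"
      unfolding th_def using g h gh by (intro powr_mono') auto
    moreover have "(g / h) powr (p - 1) \<ge> 1 + (p - 1) * (g / h - 1)"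
      by (rule bernoulli_powr) (use g h p in auto)
    moreover have "g / h - 1 \<ge> - (beta / (g * s))"
    proof -
      have "g / h - 1 = - ((- b / s) / h)" using h s by (simp add: h_def field_simps)
      moreover have "(- b / s) / h \<le> (beta / s) / g"
        by (intro frac_le divide_right_mono) (use 3 s g gh beta in auto)
      ultimately show ?thesis by (simp add: mult.commute)
    qed
    then have "(p - 1) * (g / h - 1) \<ge> (p - 1) * (- (beta / (g * s)))"
      using p by (intro mult_left_mono) auto
    ultimately have th: "th \<ge> 1 - (p - 1) * beta / (g * s)" by simp
    define E where "E = p / 2 * b\<^sup>2 + et"
    have "b\<^sup>2 \<le> beta\<^sup>2" using 3 by (simp add: abs_le_square_iff[symmetric])
    then have E: "E > 0" "E \<le> p / 2 * beta\<^sup>2 + et"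
      using p et by (auto simp: E_def intro!: add_nonneg_pos mult_left_mono)
    have "riccati p g h \<ge> M * th * (p / 2 * b\<^sup>2) / s\<^sup>2"
      unfolding Mth using riccati_ge_quadratic[OF p g order_refl gh] by (simp add: hg mult_ac)
    then have "M * (th * E / s\<^sup>2) \<le> riccati p g h + (p - 1) * g powr (p - 2) * et / s\<^sup>2"
      unfolding Mth[symmetric] by (simp add: E_def algebra_simps add_divide_distrib)
    then show "M * ((b - sigma / t\<^sup>2 + D\<^sup>2 / 2) / s\<^sup>2) < riccati p g h + (p - 1) * g powr (p - 2) * et / s\<^sup>2"
    proof (rule key)
      have "E - (p - 1) * beta / (g * s) * E \<le> th * E"
        using mult_right_mono[OF th, of E] E by (simp add: algebra_simps)
      moreover have "(p - 1) * beta / (g * s) * E \<le> (p - 1) * beta / (g * s) * (p / 2 * beta\<^sup>2 + et)"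
        using E p g s beta by (intro mult_left_mono) auto
      ultimately show "b - sigma / t\<^sup>2 + D\<^sup>2 / 2 < th * E"
        using s2 Q D2 unfolding E_def by linarith
    qed
  qed
qed

section \<open>Comparison on annuli and the lower bound (a)\<close>

lemma compact_annulus: "compact {x :: 'a :: euclidean_space. a \<le> norm x \<and> norm x \<le> b}"
proof -
  have "{x :: 'a. a \<le> norm x \<and> norm x \<le> b} = {x. a \<le> norm x} \<inter> cball 0 b" by auto
  moreover have "closed {x :: 'a. a \<le> norm x}" by (intro closed_Collect_le continuous_intros)
  ultimately show ?thesis by (simp add: closed_Int_compact)
qed

text \<open>At a maximum of the quotient of \<open>\<phi> (norm x)\<close> and \<open>w\<close>
  inside the annulus, a multiple of the radial function touches \<open>w\<close> from below, and
  \<open>riccati_of_touching\<close> contradicts \<open>strict\<close>. A maximal value above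
  \<open>M\<close> is excluded on the outer sphere by \<open>phiR\<close> and on the inner one by
  \<open>bdry\<close>.\<close>

lemma annulus_comparison:
  fixes w :: "real ^ 'n \<Rightarrow> real" and p g eps r1 R M :: real
  assumes p: "p \<ge> 2" and g: "g = (real CARD('n) - p) / p"
    and C: "C2_on T w" and sub: "{x. norm x \<ge> r1} \<subseteq> T" and r1: "r1 > 1" and R: "R > r1"
    and pos: "\<And>x. norm x \<ge> r1 \<Longrightarrow> w x > 0"
    and super: "\<And>x. norm x > r1 \<Longrightarrow> hardy_op p (g powr p) eps w x \<ge> 0"
    and cont: "continuous_on {r1..R} \<phi>" and phiR: "\<phi> R = 0"
    and D: "\<And>r. r1 < r \<Longrightarrow> r < R \<Longrightarrow> (\<phi> has_real_derivative - \<phi> r * h (ln r) / r) (at r)"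
    and Dh: "\<And>r. r1 < r \<Longrightarrow> r < R \<Longrightarrow> (h has_real_derivative h1 (ln r)) (at (ln r))"
    and hpos: "\<And>r. r1 < r \<Longrightarrow> r < R \<Longrightarrow> h (ln r) > 0"
    and strict: "\<And>r. r1 < r \<Longrightarrow> r < R \<Longrightarrow>
      (p - 1) * h (ln r) powr (p - 2) * h1 (ln r) < riccati p g (h (ln r)) + eps / (ln r)\<^sup>2"
    and bdry: "\<And>x. norm x = r1 \<Longrightarrow> \<phi> r1 \<le> M * w x" and M: "M > 0"
    and x: "r1 \<le> norm x" "norm x \<le> R"
  shows "\<phi> (norm x) \<le> M * w x"
proof -
  define A where "A = {x :: real ^ 'n. r1 \<le> norm x \<and> norm x \<le> R}"
  have "compact A" unfolding A_def by (rule compact_annulus)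
  moreover have "x \<in> A" using x by (simp add: A_def)
  moreover have "continuous_on A (\<lambda>x. \<phi> (norm x) / w x)"
  proof (intro continuous_on_divide)
    show "continuous_on A (\<lambda>x. \<phi> (norm x))"
      by (rule continuous_on_compose2[OF cont]) (auto simp: A_def intro: continuous_intros)
    have "continuous_on T w"
      using C by (auto simp: C2_on_def intro: differentiable_imp_continuous_on)
    then show "continuous_on A w" by (rule continuous_on_subset) (use sub in \<open>auto simp: A_def\<close>)
    show "\<forall>x\<in>A. w x \<noteq> 0" using pos by (fastforce simp: A_def)
  qed
  ultimately obtain x0 where x0: "x0 \<in> A" "\<And>y. y \<in> A \<Longrightarrow> \<phi> (norm y) / w y \<le> \<phi> (norm x0) / w x0"
    using continuous_attains_sup[of A] by blast
  define m where "m = \<phi> (norm x0) / w x0"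
  have w0: "w x0 > 0" using pos x0(1) by (simp add: A_def)
  have "m \<le> M"
  proof (rule ccontr)
    assume "\<not> m \<le> M"
    with M have m: "m > M" "m > 0" by auto
    have "norm x0 \<noteq> R"
    proof
      assume "norm x0 = R"
      then have "m = 0" by (simp add: m_def phiR)
      with m show False by simp
    qed
    moreover have "norm x0 \<noteq> r1"
    proof
      assume "norm x0 = r1"
      then have "m \<le> M" using bdry[of x0] w0 by (simp add: m_def divide_le_eq)
      with m show False by simp
    qed
    ultimately have nx: "r1 < norm x0" "norm x0 < R" using x0(1) by (auto simp: A_def)
    have tl: "((\<lambda>x. norm x) \<longlongrightarrow> norm x0) (nhds x0)"
      using tendsto_norm[OF filterlim_ident] .
    have ev: "\<forall>\<^sub>F r in nhds (norm x0). r \<in> {r1<..<R}"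
      by (rule eventually_nhds_in_open) (use nx in auto)
    have "riccati p g (h (ln (norm x0))) + eps / (ln (norm x0))\<^sup>2
      \<le> (p - 1) * h (ln (norm x0)) powr (p - 2) * h1 (ln (norm x0))"
    \<comment> \<open>Division by \<open>m\<close> produces touching at \<open>x0\<close> and leaves
      \<open>h\<close> unchanged, since \<open>h\<close> is a logarithmic derivative.\<close>
    proof (rule riccati_of_touching[OF p g C, where \<phi> = "\<lambda>r. \<phi> r / m"])
      show "x0 \<in> T" using sub nx by auto
      show "\<forall>\<^sub>F r in nhds (norm x0). ((\<lambda>r. \<phi> r / m) has_real_derivative - (\<phi> r / m) * h (ln r) / r) (at r)"
        using ev
      proof eventually_elim
        case (elim r)
        then show ?case using DERIV_cdivide[OF D[of r], of m] by (simp add: mult_ac)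
      qed
      have "\<forall>\<^sub>F y in nhds x0. norm y \<in> {r1<..<R}"
        by (rule topological_tendstoD[OF tl]) (use nx in auto)
      then show "\<forall>\<^sub>F y in nhds x0. \<phi> (norm y) / m \<le> w y"
      proof eventually_elim
        case (elim y)
        then have "\<phi> (norm y) / w y \<le> m" unfolding m_def by (intro x0(2)) (auto simp: A_def)
        moreover have "w y > 0" using elim by (intro pos) auto
        ultimately show ?case using m by (simp add: field_simps)
      qed
      have "\<phi> (norm x0) = m * w x0" using w0 by (simp add: m_def)
      then show "\<phi> (norm x0) / m = w x0" using m(2) by simp
    qed (use nx r1 super Dh hpos w0 in auto)
    with strict[of "norm x0"] nx show False by simp
  qed
  moreover have "\<phi> (norm x) / w x \<le> m" unfolding m_def by (rule x0(2)) fact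
  ultimately have "\<phi> (norm x) / w x \<le> M" by linarith
  then show ?thesis using pos[of x] x by (simp add: field_simps)
qed

lemma supersolution_lower_bound:
  fixes w :: "real ^ 'n \<Rightarrow> real" and p g eps r0 beta betab sigma :: real
  assumes p: "p \<ge> 2" and g: "g = (real CARD('n) - p) / p" "g > 0" and r0: "r0 > exp 1"
    and beta: "0 < beta" "beta \<le> betab" and sum: "p / 2 * (beta + betab) = 1"
    and eps: "eps = (p - 1) * g powr (p - 2) * (p / 2 * (beta * betab))"
    and sigma: "sigma > 0"
    and pos: "\<And>x. norm x \<ge> r0 \<Longrightarrow> w x > 0"
    and super: "supersol p (g powr p) eps r0 w"
  shows "\<exists>C>0. \<forall>x. norm x \<ge> r0 \<longrightarrow>
    norm x powr (- g) * ln (norm x) powr beta * ln (ln (norm x)) powr (- sigma) \<le> C * w x"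
proof -
  define u where "u r = r powr (- g) * ln r powr beta * ln (ln r) powr (- sigma)" for r
  obtain T where T: "C2_on T w" "{x. norm x \<ge> r0} \<subseteq> T"
    using super unfolding supersol_def C2_ext_def by blast
  \<comment> \<open>\<open>K / s\<close> is the left side of condition \<open>s2\<close> of
    \<open>strict_subsolution\<close>; with \<open>t = ln s\<close> that condition reads
    \<open>(ln s)^2 / s < sigma / K\<close>.\<close>
  define K where "K = (p - 1) * beta / g * (p / 2 * beta\<^sup>2 + p / 2 * (beta * betab))"
  have K: "K > 0" unfolding K_def using p g(2) beta by (intro mult_pos_pos add_nonneg_pos) auto
  have "\<forall>\<^sub>F s in at_top. (ln s)\<^sup>2 / s < sigma / K"
  proof (rule order_tendstoD)
    show "((\<lambda>s::real. (ln s)\<^sup>2 / s) \<longlongrightarrow> 0) at_top" by real_asymp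
  qed (use K sigma in auto)
  then obtain s1 where s1: "\<And>s. s \<ge> s1 \<Longrightarrow> (ln s)\<^sup>2 / s < sigma / K"
    unfolding eventually_at_top_linorder by blast
  \<comment> \<open>The entry \<open>s1\<close> secures the smallness condition,
    \<open>ln r0 + 1\<close> makes \<open>r1\<close> exceed \<open>r0\<close>, and
    \<open>beta / g + 1\<close> keeps \<open>h\<close> positive. Nothing here depends on the point
    \<open>x\<close> of the final bound, so one \<open>r1\<close> serves all cutoffs.\<close>
  define r1 where "r1 = exp (max (max s1 (ln r0 + 1)) (max (exp 1) (beta / g + 1)))"
  have r0': "r0 > 0" using r0 exp_gt_zero[of "1::real"] by linarith
  have lnr0: "ln r0 > 1" using r0 r0' by (metis exp_gt_zero ln_exp ln_less_cancel_iff)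
  have ln: "ln r > 1" "ln (ln r) > 0" if "r \<ge> r0" for r
  proof -
    show "ln r > 1" using lnr0 ln_mono[of r0 r] that r0' by linarith
    then show "ln (ln r) > 0" by simp
  qed
  have lnr1: "ln r1 \<ge> s1" "ln r1 > ln r0" "ln r1 \<ge> exp 1" "ln r1 > beta / g"
    by (auto simp: r1_def)
  have "exp (ln r0) < exp (ln r1)" using lnr1(2) by (simp only: exp_less_cancel_iff)
  then have r1: "r1 > r0" using r0' by (simp add: r1_def)
  have big: "ln r > ln r1" if "r > r1" for r
    using that r1 r0' by simp
  have cu: "continuous_on {r0..} u"
  proof -
    have "ln x \<noteq> 0" "ln (ln x) \<noteq> 0" "x \<noteq> 0" if "x \<ge> r0" for x using ln[OF that] r0' that by auto
    then show ?thesis unfolding u_def by (auto intro!: continuous_intros)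
  qed
  have cw: "continuous_on T w"
    using T(1) by (auto simp: C2_on_def intro: differentiable_imp_continuous_on)
  obtain C where C: "C > 0" "\<And>x. r0 \<le> norm x \<Longrightarrow> norm x \<le> r1 \<Longrightarrow> u (norm x) \<le> C * w x"
  proof -
    define A where "A = {x :: real ^ 'n. r0 \<le> norm x \<and> norm x \<le> r1}"
    have "continuous_on A (\<lambda>x. u (norm x) / w x)"
    proof (intro continuous_on_divide)
      show "continuous_on A (\<lambda>x. u (norm x))"
        by (rule continuous_on_compose2[OF cu]) (auto simp: A_def intro: continuous_intros)
      show "continuous_on A w" by (rule continuous_on_subset[OF cw]) (use T in \<open>auto simp: A_def\<close>)
      show "\<forall>x\<in>A. w x \<noteq> 0" using pos by (fastforce simp: A_def)
    qed
    then have "bounded ((\<lambda>x. u (norm x) / w x) ` A)"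
      by (intro compact_imp_bounded compact_continuous_image) (auto simp: A_def compact_annulus)
    then obtain B where B: "B > 0" "\<And>x. x \<in> A \<Longrightarrow> \<bar>u (norm x) / w x\<bar> \<le> B"
      unfolding bounded_pos by auto
    show ?thesis
    proof (rule that[OF B(1)])
      fix x :: "real ^ 'n" assume x: "r0 \<le> norm x" "norm x \<le> r1"
      then have "u (norm x) / w x \<le> B"
        using order_trans[OF abs_ge_self B(2)[of x]] by (simp add: A_def)
      then show "u (norm x) \<le> B * w x" using pos[OF x(1)] by (simp add: field_simps)
    qed
  qed
  have "u (norm x) \<le> (4 * C) * w x" if x: "norm x \<ge> r0" for x
  proof (cases "norm x \<le> r1")
    case True
    then have "u (norm x) \<le> C * w x" by (rule C(2)[OF x])
    also have "\<dots> \<le> (4 * C) * w x" using C(1) pos[OF x] by simp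
    finally show ?thesis .
  next
    case False
    define t1 where "t1 = ln (ln r1)"
    define t where "t = ln (ln (norm x))"
    have t1: "t1 > 0" using ln(2)[of r1] r1 by (simp add: t1_def)
    have t: "t > t1" using big[of "norm x"] False ln(1)[OF x] ln(1)[of r1] r1 by (simp add: t1_def t_def)
    \<comment> \<open>The cutoff \<open>(2 * t - ln (ln r))^2\<close> vanishes at \<open>R\<close>,
      equals \<open>t^2\<close> at \<open>norm x\<close> and is at most \<open>(2 * t)^2\<close> at
      \<open>r1\<close>. The ratio 4 of the last two explains the constant
      \<open>4 * C\<close>.\<close>
    define R where "R = exp (exp (2 * t))"
    define \<phi> where "\<phi> r = u r * (2 * t - ln (ln r))\<^sup>2" for r
    define b where "b s = beta - sigma / ln s - 2 / (2 * t - ln s)" for s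
    define h where "h s = g - b s / s" for s
    define h1 where "h1 s = (b s - sigma / (ln s)\<^sup>2 + (2 / (2 * t - ln s))\<^sup>2 / 2) / s\<^sup>2" for s
    have "norm x > 0" "ln (norm x) > 0" using x r0' ln(1)[OF x] by linarith+
    then have nx: "norm x = exp (exp t)"
      unfolding t_def by (simp only: exp_ln)
    have R: "norm x \<le> R" using t t1 by (simp add: nx R_def)
    have in_range: "ln r > 1" "ln (ln r) > 0" "ln (ln r) < 2 * t" "r > 1" if "r1 < r" "r < R" for r
    proof -
      show l: "ln r > 1" "ln (ln r) > 0" using ln[of r] r1 that by auto
      show r: "r > 1" using l by (smt (verit) ln_le_zero_iff r0' r1 that(1))
      have "ln r < exp (2 * t)" using that r by (metis R_def exp_gt_zero less_trans ln_exp ln_less_cancel_iff zero_less_one)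
      then have "ln (ln r) < ln (exp (2 * t))" using l by (subst ln_less_cancel_iff) auto
      then show "ln (ln r) < 2 * t" by simp
    qed
    have "\<phi> (norm x) \<le> (C * (2 * t - t1)\<^sup>2) * w x"
    proof (rule annulus_comparison[where \<phi> = \<phi> and h = h and ?h1.0 = h1, OF p g(1) T(1) _ _ _ _ _ _ _ _ _ _ _ _ _ _ R])
      show "{x. r1 \<le> norm x} \<subseteq> T" using T(2) r1 by auto
      show "r1 > 1" using ln(1)[of r1] r1 r0' by (smt (verit) ln_le_zero_iff)
      show "r1 < R" using False R by simp
      show "r1 \<le> norm x" using False by simp
      show "w y > 0" if "norm y \<ge> r1" for y using that r1 pos by simp
      show "hardy_op p (g powr p) eps w y \<ge> 0" if "norm y > r1" for y
        using that r1 super by (simp add: supersol_def)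
      show "continuous_on {r1..R} \<phi>"
      proof -
        have "ln x \<noteq> 0" "x \<noteq> 0" if "x \<ge> r1" for x using ln[of x] r0' that r1 by auto
        then show ?thesis unfolding \<phi>_def using r1 r0'
          by (auto intro!: continuous_intros continuous_on_subset[OF cu])
      qed
      show "\<phi> R = 0" by (simp add: \<phi>_def R_def)
      show "\<phi> r1 \<le> (C * (2 * t - t1)\<^sup>2) * w y" if "norm y = r1" for y
        using mult_right_mono[OF C(2)[of y], of "(2 * t - t1)\<^sup>2"] that r1
        by (simp add: \<phi>_def t1_def mult_ac)
      show "0 < C * (2 * t - t1)\<^sup>2" using C(1) t t1 by simp
      fix r assume r: "r1 < r" "r < R"
      note ir = in_range[OF r]
      have lr: "ln r > ln r1" using big r by simp
      show "(\<phi> has_real_derivative - \<phi> r * h (ln r) / r) (at r)"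
      proof -
        define z where "z = 2 * t - ln (ln r)"
        have z: "z > 0" using ir by (simp add: z_def)
        have l0: "((\<lambda>r. r) has_real_derivative 1) (at r)" by (rule DERIV_ident)
        have l1: "(ln has_real_derivative 1 / r) (at r)" using ir by (intro DERIV_ln_divide) auto
        have l2: "((\<lambda>r. ln (ln r)) has_real_derivative 1 / ln r * (1 / r)) (at r)"
          by (rule DERIV_chain2[where f = ln, OF DERIV_ln_divide l1]) (use ir in linarith)
        \<comment> \<open>Each factor is differentiated as itself times its logarithmic derivative,
          so that the product rule just adds these up to \<open>- h (ln r) / r\<close>.\<close>
        have pw: "((\<lambda>r. f r powr c) has_real_derivative f r powr c * (c * f' / f r)) (at r)"
          if "(f has_real_derivative f') (at r)" "f r > 0" for f f' c
          by (rule DERIV_cong[OF DERIV_fun_powr[OF that]]) (use that(2) in \<open>simp add: powr_diff\<close>)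
        have l3: "((\<lambda>r. (2 * t - ln (ln r))\<^sup>2) has_real_derivative z\<^sup>2 * (- 2 / (z * r * ln r))) (at r)"
          using DERIV_power[OF DERIV_diff[OF DERIV_const l2], of "2 * t" 2] z ir
          by (elim DERIV_cong) (unfold z_def[symmetric], simp add: field_simps power2_eq_square)
        have pos3: "r > 0" "ln r > 0" "ln (ln r) > 0" using ir by linarith+
        have "(\<phi> has_real_derivative u r * z\<^sup>2 *
           (- g / r + beta / (r * ln r) - sigma / (r * ln r * ln (ln r)) - 2 / (z * r * ln r))) (at r)"
          unfolding \<phi>_def u_def
          by (rule DERIV_cong[OF DERIV_mult[OF DERIV_mult[OF DERIV_mult[OF
                pw[OF l0 pos3(1)] pw[OF l1 pos3(2)]] pw[OF l2 pos3(3)]] l3]])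
             (unfold z_def[symmetric], simp add: algebra_simps)
        then have "(\<phi> has_real_derivative u r * (2 * t - ln (ln r))\<^sup>2 *
           (- g / r + beta / (r * ln r) - sigma / (r * ln r * ln (ln r)) - 2 / ((2 * t - ln (ln r)) * r * ln r))) (at r)"
          unfolding z_def .
        moreover have "- g / r + beta / (r * ln r) - sigma / (r * ln r * ln (ln r)) - 2 / ((2 * t - ln (ln r)) * r * ln r)
           = - h (ln r) / r"
          using ir by (simp add: h_def b_def field_simps)
        ultimately show ?thesis by (simp add: \<phi>_def)
      qed
      show "(h has_real_derivative h1 (ln r)) (at (ln r))"
      proof -
        define s where "s = ln r"
        have s: "s > 1" "ln s > 0" "ln s < 2 * t" using ir by (auto simp: s_def)
        have "(b has_real_derivative (sigma / (ln s)\<^sup>2 - (2 / (2 * t - ln s))\<^sup>2 / 2) / s) (at s)"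
        proof (rule DERIV_cong)
          show "(b has_real_derivative 0 - (0 * ln s - sigma * (1 / s)) / (ln s * ln s)
              - (0 * (2 * t - ln s) - 2 * (0 - 1 / s)) / ((2 * t - ln s) * (2 * t - ln s))) (at s)"
            unfolding b_def using s by (intro DERIV_diff DERIV_divide DERIV_const DERIV_ln_divide) auto
        qed (simp add: power2_eq_square diff_divide_distrib mult_ac)
        then have "(h has_real_derivative 0 - ((sigma / (ln s)\<^sup>2 - (2 / (2 * t - ln s))\<^sup>2 / 2) / s * s - b s * 1) / (s * s)) (at s)"
          unfolding h_def using s by (intro DERIV_diff DERIV_divide DERIV_const DERIV_ident) auto
        moreover have "0 - ((sigma / (ln s)\<^sup>2 - (2 / (2 * t - ln s))\<^sup>2 / 2) / s * s - b s * 1) / (s * s) = h1 s"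
          using s unfolding h1_def by (simp add: power2_eq_square diff_divide_distrib add_divide_distrib)
        ultimately show ?thesis by (simp add: s_def)
      qed
      have D0: "2 / (2 * t - ln (ln r)) \<ge> 0" using ir by simp
      have "beta < g * ln r1" using lnr1(4) g(2) by (simp add: field_simps)
      then have c1: "beta < g * ln r" using mult_strict_left_mono[OF lr g(2)] by linarith
      have c2: "(p - 1) * beta / (g * ln r) * (p / 2 * beta\<^sup>2 + p / 2 * (beta * betab)) < sigma / (ln (ln r))\<^sup>2"
      proof -
        have "(ln (ln r))\<^sup>2 / ln r < sigma / K" using s1[of "ln r"] lr lnr1 by simp
        then have "K / ln r < sigma / (ln (ln r))\<^sup>2" using K ir by (simp add: field_simps)
        then show ?thesis by (simp add: K_def mult_ac)
      qed
      have "ln r > 0" using ir by simp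
      note S = strict_subsolution[OF p g(2) beta sum sigma ir(2) \<open>ln r > 0\<close> D0 c1 c2]
      show "h (ln r) > 0" using S(1) by (simp add: h_def b_def)
      show "(p - 1) * h (ln r) powr (p - 2) * h1 (ln r) < riccati p g (h (ln r)) + eps / (ln r)\<^sup>2"
        using S(2) by (simp add: h_def b_def h1_def eps)
    qed
    then have "u (norm x) * t\<^sup>2 \<le> (C * (2 * t - t1)\<^sup>2) * w x"
      by (simp add: \<phi>_def t_def[symmetric])
    also have "\<dots> \<le> (C * (2 * t)\<^sup>2) * w x"
      using C(1) pos[OF x] t t1 by (intro mult_right_mono mult_left_mono power_mono) auto
    finally have "u (norm x) * t\<^sup>2 \<le> ((4 * C) * w x) * t\<^sup>2" by (simp add: power_mult_distrib mult_ac)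
    then show ?thesis using t t1 by simp
  qed
  then show ?thesis using C(1) unfolding u_def by (intro exI[of _ "4 * C"]) auto
qed

section \<open>Differential inequalities of Riccati type\<close>

text \<open>Once negative, \<open>y\<close> stays negative while \<open>inverse y\<close> grows at
  least at rate \<open>c\<close>, so \<open>inverse y\<close> would become nonnegative in finite
  time.\<close>

lemma nonneg_of_quadratic_decay:
  fixes y y1 :: "real \<Rightarrow> real"
  assumes D: "\<And>s. s \<ge> a \<Longrightarrow> (y has_real_derivative y1 s) (at s)"
    and le: "\<And>s. s \<ge> a \<Longrightarrow> y1 s \<le> - c * (y s)\<^sup>2" and c: "c > 0" and s: "s \<ge> a"
  shows "y s \<ge> 0"
proof (rule ccontr)
  assume "\<not> y s \<ge> 0"
  then have ys: "y s < 0" by simp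
  have dec: "y u \<le> y s" if "u \<ge> s" for u
    using that
  proof (rule DERIV_nonpos_imp_nonincreasing)
    fix x assume "s \<le> x" "x \<le> u"
    then have "x \<ge> a" using s by simp
    have "c * (y x)\<^sup>2 \<ge> 0" using c by simp
    then have "y1 x \<le> 0" using le[OF \<open>x \<ge> a\<close>] by linarith
    then show "\<exists>z. (y has_real_derivative z) (at x) \<and> z \<le> 0" using D[OF \<open>x \<ge> a\<close>] by blast
  qed
  \<comment> \<open>Growth at rate \<open>c\<close> from the value \<open>inverse (y s)\<close>
    reaches 0 at this time.\<close>
  define u where "u = s - inverse (y s) / c"
  have us: "s \<le> u" using ys c by (simp add: u_def divide_nonpos_pos)
  have "inverse (y s) - c * s \<le> inverse (y u) - c * u"
    using us
  proof (rule DERIV_nonneg_imp_nondecreasing)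
    fix x assume "s \<le> x" "x \<le> u"
    then have x: "x \<ge> a" "y x < 0" using s dec[of x] ys by auto
    have "((\<lambda>x. inverse (y x) - c * x) has_real_derivative - (inverse (y x) * y1 x * inverse (y x)) - c) (at x)"
      by (rule derivative_eq_intros D[OF x(1)] refl | use x in simp)+
    moreover have "- (inverse (y x) * y1 x * inverse (y x)) - c \<ge> 0"
      using le[OF x(1)] x(2) by (simp add: field_simps power2_eq_square)
    ultimately show "\<exists>z. ((\<lambda>x. inverse (y x) - c * x) has_real_derivative z) (at x) \<and> z \<ge> 0" by blast
  qed
  then have "inverse (y u) \<ge> 0" using c by (simp add: u_def field_simps)
  moreover have "y u < 0" using dec[OF us] ys by simp
  ultimately show False by simp
qed

text \<open>Two monotone quantities. For \<open>\<Delta> > 0\<close> it is \<open>L + k * d\<close>,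
  and \<open>B\<close> turns its bound into one for \<open>L\<close>. For
  \<open>\<Delta> = 0\<close> the decay of \<open>d\<close> is only quadratic; then \<open>d\<close>
  is nonnegative, and \<open>L + t * d - 2 / p * ln t\<close> is nonincreasing.\<close>

lemma integrated_riccati_bound:
  fixes d d1 L :: "real \<Rightarrow> real" and p \<Delta> B \<tau> a :: real
  assumes p: "p > 0" and a: "a \<ge> 1"
    and L: "\<And>t. t \<ge> a \<Longrightarrow> (L has_real_derivative d t) (at t)"
    and D: "\<And>t. t \<ge> a \<Longrightarrow> (d has_real_derivative d1 t) (at t)"
    and le: "\<And>t. t \<ge> a \<Longrightarrow> d1 t \<le> - (p / 2) * (d t * (d t + \<Delta>))"
    and B: "\<And>t. t \<ge> a \<Longrightarrow> d t \<ge> - B"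
    and cases: "(\<Delta> > 0 \<and> \<tau> > 0) \<or> (\<Delta> = 0 \<and> \<tau> > 2 / p)"
  obtains C where "\<And>t. t \<ge> a \<Longrightarrow> L t \<le> C + \<tau> * ln t"
proof -
  have "\<exists>C. \<forall>t\<ge>a. L t \<le> C + \<tau> * ln t"
    using cases
  proof (elim disjE conjE)
    assume \<Delta>: "\<Delta> > 0" and \<tau>: "\<tau> > 0"
    \<comment> \<open>With this \<open>k\<close> the linear part of the bound for
      \<open>k * d1\<close> is exactly \<open>- d\<close>.\<close>
    define k where "k = 2 / (p * \<Delta>)"
    have k: "k > 0" "k * (p / 2) * \<Delta> = 1" using p \<Delta> by (auto simp: k_def)
    define C where "C = L a + k * d a + k * B"
    have "L t \<le> C + \<tau> * ln t" if t: "t \<ge> a" for t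
    proof -
      have "L t + k * d t \<le> L a + k * d a"
        using t
      proof (rule DERIV_nonpos_imp_nonincreasing)
        fix x assume "a \<le> x" "x \<le> t"
        have "((\<lambda>x. L x + k * d x) has_real_derivative d x + k * d1 x) (at x)"
          by (intro DERIV_add DERIV_cmult L D) fact+
        moreover have "d x + k * d1 x \<le> 0"
        proof -
          have "k * d1 x \<le> k * (- (p / 2) * (d x * (d x + \<Delta>)))"
            using le[OF \<open>a \<le> x\<close>] k by (intro mult_left_mono) auto
          also have "\<dots> = - (k * (p / 2) * (d x)\<^sup>2) - (k * (p / 2) * \<Delta>) * d x"
            by (simp add: algebra_simps power2_eq_square)
          also have "\<dots> \<le> - d x" unfolding k(2) using k(1) p by simp
          finally show ?thesis by simp
        qed
        ultimately show "\<exists>z. ((\<lambda>x. L x + k * d x) has_real_derivative z) (at x) \<and> z \<le> 0" by blast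
      qed
      moreover have "k * d t \<ge> k * (- B)" using B[OF t] k by (intro mult_left_mono) auto
      moreover have "\<tau> * ln t \<ge> 0" using \<tau> t a by simp
      ultimately show ?thesis by (simp add: C_def)
    qed
    then show ?thesis by blast
  next
    assume \<Delta>: "\<Delta> = 0" and \<tau>: "\<tau> > 2 / p"
    have d: "d t \<ge> 0" if "t \<ge> a" for t
      by (rule nonneg_of_quadratic_decay[of a d d1 "p / 2"])
         (use D le p that in \<open>auto simp: \<Delta> power2_eq_square\<close>)
    define C where "C = L a + a * d a - 2 / p * ln a"
    have "L t \<le> C + \<tau> * ln t" if t: "t \<ge> a" for t
    proof -
      have "L t + t * d t - 2 / p * ln t \<le> L a + a * d a - 2 / p * ln a"
        using t
      proof (rule DERIV_nonpos_imp_nonincreasing)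
        fix x assume "a \<le> x" "x \<le> t"
        then have x: "x > 0" using a by simp
        have "((\<lambda>x. L x + x * d x - 2 / p * ln x) has_real_derivative
            d x + (1 * d x + d1 x * x) - 2 / p * (1 / x)) (at x)"
          by (intro DERIV_add DERIV_diff DERIV_mult DERIV_cmult DERIV_ident DERIV_ln_divide L D x) fact+
        moreover have "d x + (1 * d x + d1 x * x) - 2 / p * (1 / x) \<le> 0"
        proof -
          have "d1 x * x \<le> - (p / 2) * (d x * d x) * x"
            using le[OF \<open>a \<le> x\<close>] x by (intro mult_right_mono) (auto simp: \<Delta>)
          \<comment> \<open>Completing the square in \<open>d x\<close> leaves
            \<open>2 / (p * x)\<close>, whose integral is the source of the threshold
            \<open>2 / p\<close> for \<open>\<tau>\<close>.\<close>
          moreover have "2 * d x - (p / 2) * (d x * d x) * x - 2 / p * (1 / x)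
            = - (p * x / 2) * (d x - 2 / (p * x))\<^sup>2"
            using p x by (simp add: field_simps power2_eq_square)
          moreover have "- (p * x / 2) * (d x - 2 / (p * x))\<^sup>2 \<le> 0"
            using p x by (intro mult_nonpos_nonneg) auto
          ultimately show ?thesis by linarith
        qed
        ultimately show "\<exists>z. ((\<lambda>x. L x + x * d x - 2 / p * ln x) has_real_derivative z) (at x) \<and> z \<le> 0" by blast
      qed
      moreover have "t * d t \<ge> 0" using d[OF t] t a by simp
      moreover have "2 / p * ln t \<le> \<tau> * ln t" using \<tau> t a by (intro mult_right_mono) auto
      ultimately show ?thesis by (simp add: C_def)
    qed
    then show ?thesis by blast
  qed
  then show thesis using that by blast
qed

section \<open>Radial supersolutions and the bound (b)\<close>

text \<open>A radial \<open>v\<close> touches itself at every point, so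
  \<open>riccati_of_touching\<close> applies to its own profile. The hypothesis \<open>rad\<close>
  supplies the first derivative of the profile and its sign; the second derivative is read off from
  \<open>v\<close> along a ray.\<close>

lemma radial_supersolution_riccati:
  fixes v :: "real ^ 'n \<Rightarrow> real" and p g eps r0 :: real
  assumes p: "p \<ge> 2" and g: "g = (real CARD('n) - p) / p" and r0: "r0 > exp 1"
    and pos: "\<And>x. norm x \<ge> r0 \<Longrightarrow> v x > 0"
    and super: "supersol p (g powr p) eps r0 v"
    and rad: "radial_strict_decr r0 v"
  obtains \<phi> h h1 where
    "\<And>x. norm x \<ge> r0 \<Longrightarrow> v x = \<phi> (norm x)"
    "\<And>r. r \<ge> r0 \<Longrightarrow> \<phi> r > 0"
    "\<And>r. r > r0 \<Longrightarrow> (\<phi> has_real_derivative - \<phi> r * h (ln r) / r) (at r)"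
    "\<And>s. s > ln r0 \<Longrightarrow> h s > 0"
    "\<And>s. s > ln r0 \<Longrightarrow> (h has_real_derivative h1 s) (at s)"
    "\<And>s. s > ln r0 \<Longrightarrow> riccati p g (h s) + eps / s\<^sup>2 \<le> (p - 1) * h s powr (p - 2) * h1 s"
proof -
  have r0': "r0 > 1" using r0 exp_gt_one[of "1::real"] by linarith
  obtain T where T: "C2_on T v" "{x. norm x \<ge> r0} \<subseteq> T"
    using super unfolding supersol_def C2_ext_def by blast
  obtain \<phi> where \<phi>: "\<And>x. norm x \<ge> r0 \<Longrightarrow> v x = \<phi> (norm x)"
    "\<And>r. r \<ge> r0 \<Longrightarrow> \<exists>d<0. (\<phi> has_real_derivative d) (at r within {r0..})"
    using rad unfolding radial_strict_decr_def by blast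
  \<comment> \<open>\<open>undefined\<close> picks some coordinate axis; by radial symmetry any ray
    carries the whole profile.\<close>
  define e :: "real ^ 'n" where "e = axis undefined 1"
  have e: "norm (r *\<^sub>R e) = r" if "r \<ge> 0" for r using that by (simp add: e_def)
  have \<phi>e: "\<phi> r = v (r *\<^sub>R e)" if "r \<ge> r0" for r using \<phi>(1)[of "r *\<^sub>R e"] e[of r] that r0' by simp
  define a where "a r = (\<Sum>i\<in>UNIV. e $ i * dpart v i (r *\<^sub>R e))" for r
  define a1 where "a1 r = (\<Sum>i\<in>UNIV. e $ i * (\<Sum>j\<in>UNIV. e $ j * dpart (dpart v i) j (r *\<^sub>R e)))" for r
  have inT: "r *\<^sub>R e \<in> T" if "r \<ge> r0" for r using T(2) e[of r] that r0' by auto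
  have da: "(\<phi> has_real_derivative a r) (at r)" if r: "r > r0" for r
  proof -
    have "((\<lambda>r. v (r *\<^sub>R e)) has_real_derivative a r) (at r)"
      using line_has_real_derivative[of v 0 r e] C2_on_differentiable(1)[OF T(1) inT[of r]] r
      by (simp add: a_def)
    then show ?thesis
    proof (rule DERIV_cong_ev[THEN iffD1, rotated -1])
      have "\<forall>\<^sub>F x in nhds r. x \<in> {r0<..}"
        by (rule eventually_nhds_in_open) (use r in auto)
      then show "\<forall>\<^sub>F x in nhds r. v (x *\<^sub>R e) = \<phi> x"
        by eventually_elim (simp add: \<phi>e)
    qed simp_all
  qed
  have neg: "a r < 0" if r: "r > r0" for r
  proof -
    obtain d where d: "d < 0" "(\<phi> has_real_derivative d) (at r within {r0..})" using \<phi>(2)[of r] r by auto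
    have "at r within {r0..} = at r" by (rule at_within_interior) (use r in simp)
    then show ?thesis using DERIV_unique[OF da[OF r]] d by auto
  qed
  have da1: "(a has_real_derivative a1 r) (at r)" if r: "r > r0" for r
    unfolding a_def a1_def
    using line_has_real_derivative[of _ 0 r e] C2_on_differentiable(2)[OF T(1) inT[of r]] r
    by (intro DERIV_sum DERIV_cmult) simp
  have \<phi>pos: "\<phi> r > 0" if "r \<ge> r0" for r
    using pos[of "r *\<^sub>R e"] e[of r] \<phi>e[OF that] that r0' by simp
  have ex: "exp s > r0" if "s > ln r0" for s :: real
    using that r0' by (metis exp_less_mono exp_ln less_trans zero_less_one)
  define h where "h s = - (exp s * a (exp s)) / \<phi> (exp s)" for s
  define h1 where "h1 s = ((- (exp s * a (exp s) + a1 (exp s) * exp s * exp s)) * \<phi> (exp s)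
     - (- (exp s * a (exp s))) * (a (exp s) * exp s)) / (\<phi> (exp s) * \<phi> (exp s))" for s
  have hd: "(h has_real_derivative h1 s) (at s)" if s: "s > ln r0" for s
  proof -
    have 1: "((\<lambda>s. a (exp s)) has_real_derivative a1 (exp s) * exp s) (at s)"
      by (rule DERIV_chain2[where f = a and g = exp, OF da1[OF ex[OF s]] DERIV_exp])
    have 2: "((\<lambda>s. \<phi> (exp s)) has_real_derivative a (exp s) * exp s) (at s)"
      by (rule DERIV_chain2[where f = \<phi> and g = exp, OF da[OF ex[OF s]] DERIV_exp])
    show ?thesis unfolding h_def h1_def
      by (rule DERIV_divide DERIV_minus DERIV_mult DERIV_exp 1 2)+
         (use \<phi>pos[of "exp s"] ex[OF s] in auto)
  qed
  have hp: "h s > 0" if s: "s > ln r0" for s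
    unfolding h_def using neg[OF ex[OF s]] \<phi>pos[of "exp s"] ex[OF s]
    by (intro divide_pos_pos) (auto simp: mult_less_0_iff)
  have \<phi>d: "(\<phi> has_real_derivative - \<phi> r * h (ln r) / r) (at r)" if r: "r > r0" for r
    using da[OF r] \<phi>pos[of r] r r0' by (simp add: h_def)
  have ric: "riccati p g (h s) + eps / s\<^sup>2 \<le> (p - 1) * h s powr (p - 2) * h1 s" if s: "s > ln r0" for s
  proof -
    define x0 where "x0 = exp s *\<^sub>R e"
    have nx: "norm x0 = exp s" using e[of "exp s"] by (simp add: x0_def)
    have x0: "norm x0 > r0" using ex[OF s] nx by simp
    have "riccati p g (h (ln (norm x0))) + eps / (ln (norm x0))\<^sup>2
      \<le> (p - 1) * h (ln (norm x0)) powr (p - 2) * h1 s"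
    proof (rule riccati_of_touching[OF p g T(1), where \<phi> = \<phi>])
      show "x0 \<in> T" using T(2) x0 by auto
      show "1 < norm x0" using x0 r0' by linarith
      have "\<forall>\<^sub>F r in nhds (norm x0). r \<in> {r0<..}"
        by (rule eventually_nhds_in_open) (use x0 in auto)
      then show "\<forall>\<^sub>F r in nhds (norm x0). (\<phi> has_real_derivative - \<phi> r * h (ln r) / r) (at r)"
        by eventually_elim (rule \<phi>d, simp)
      have tl: "((\<lambda>x. norm x) \<longlongrightarrow> norm x0) (nhds x0)"
        using tendsto_norm[OF filterlim_ident] .
      have "\<forall>\<^sub>F y in nhds x0. norm y \<in> {r0<..}"
        by (rule topological_tendstoD[OF tl]) (use x0 in auto)
      then show "\<forall>\<^sub>F x in nhds x0. \<phi> (norm x) \<le> v x"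
        by eventually_elim (simp add: \<phi>(1))
    qed (use x0 r0' super hd[OF s] hp[OF s] pos[of x0] \<phi>(1)[of x0] in \<open>auto simp: nx supersol_def\<close>)
    then show ?thesis by (simp add: nx)
  qed
  show thesis
    by (rule that[of \<phi> h h1]) (fact \<phi>(1) \<phi>pos \<phi>d hp hd ric)+
qed

lemma radial_supersolution_upper_bound:
  fixes v :: "real ^ 'n \<Rightarrow> real" and p g eps r0 beta betab \<tau> :: real
  assumes p: "p \<ge> 2" and g: "g = (real CARD('n) - p) / p" "g > 0" and r0: "r0 > exp 1"
    and beta: "0 < beta" "beta \<le> betab" and sum: "p / 2 * (beta + betab) = 1"
    and eps: "eps = (p - 1) * g powr (p - 2) * (p / 2 * (beta * betab))"
    and \<tau>: "(beta < betab \<and> \<tau> > 0) \<or> (beta = betab \<and> \<tau> > 2 / p)"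
    and pos: "\<And>x. norm x \<ge> r0 \<Longrightarrow> v x > 0"
    and super: "supersol p (g powr p) eps r0 v"
    and rad: "radial_strict_decr r0 v"
  obtains C r1 where "C > 0" "r1 > 0"
    "\<And>x. norm x \<ge> r1 \<Longrightarrow> v x > 0 \<and>
       v x \<le> C * (norm x powr (- g) * ln (norm x) powr betab * ln (ln (norm x)) powr \<tau>)"
proof -
  have r0': "r0 > 1" using r0 exp_gt_one[of "1::real"] by linarith
  obtain \<phi> h h1 where v: "\<And>x. norm x \<ge> r0 \<Longrightarrow> v x = \<phi> (norm x)"
    and \<phi>pos: "\<And>r. r \<ge> r0 \<Longrightarrow> \<phi> r > 0"
    and \<phi>: "\<And>r. r > r0 \<Longrightarrow> (\<phi> has_real_derivative - \<phi> r * h (ln r) / r) (at r)"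
    and hpos: "\<And>s. s > ln r0 \<Longrightarrow> h s > 0"
    and h: "\<And>s. s > ln r0 \<Longrightarrow> (h has_real_derivative h1 s) (at s)"
    and ric: "\<And>s. s > ln r0 \<Longrightarrow> riccati p g (h s) + eps / s\<^sup>2 \<le> (p - 1) * h s powr (p - 2) * h1 s"
    by (rule radial_supersolution_riccati[OF p g(1) r0 _ super rad]) (rule pos, assumption, rule that)
  define et where "et = p / 2 * (beta * betab)"
  have et: "et > 0" using p beta by (simp add: et_def)
  have M: "(p - 1) * h s powr (p - 2) > 0" if "s > ln r0" for s
    using hpos[OF that] p by simp
  \<comment> \<open>\<open>y = g - h\<close> satisfies \<open>y' \<le> - y^2\<close> on a half line,
    where a negative value would blow up. The shift by 1 provides a closed half line with
    \<open>h\<close> differentiable at its endpoint too.\<close>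
  have hg: "h s \<le> g" if s: "s \<ge> ln r0 + 1" for s
  proof -
    have "g - h s \<ge> 0"
    proof (rule nonneg_of_quadratic_decay[of "ln r0 + 1" "\<lambda>s. g - h s" "\<lambda>s. - h1 s" 1])
      fix s assume "s \<ge> ln r0 + 1"
      then have s: "s > ln r0" by simp
      show "((\<lambda>s. g - h s) has_real_derivative - h1 s) (at s)"
        using DERIV_diff[OF DERIV_const h[OF s], of g] by simp
      have "eps / s\<^sup>2 \<ge> 0" unfolding eps et_def[symmetric] using et p by simp
      then have "(p - 1) * h s powr (p - 2) * (h s - g)\<^sup>2 \<le> (p - 1) * h s powr (p - 2) * h1 s"
        using riccati_ge_square[OF p g(2) hpos[OF s]] ric[OF s] by linarith
      then have "(h s - g)\<^sup>2 \<le> h1 s" using M[OF s] by (metis mult_le_cancel_left_pos)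
      then show "- h1 s \<le> - 1 * (g - h s)\<^sup>2" by (simp add: power2_commute)
    qed (use s in auto)
    then show ?thesis by simp
  qed
  \<comment> \<open>Since \<open>h \<le> g\<close>, the term \<open>eps / s^2\<close> is at least
    \<open>et / s^2\<close> times the weight at \<open>h\<close>, so the whole inequality can be
    divided by that weight.\<close>
  have h1: "h1 s \<ge> p / 2 * (g - h s)\<^sup>2 + et / s\<^sup>2" if s: "s \<ge> ln r0 + 1" for s
  proof -
    have s': "s > ln r0" using s by simp
    have "(p - 1) * h s powr (p - 2) * (p / 2 * (g - h s)\<^sup>2) \<le> riccati p g (h s)"
      using riccati_ge_quadratic[OF p hpos[OF s'] hg[OF s] order_refl]
      by (simp add: power2_commute mult_ac)
    moreover have "(p - 1) * h s powr (p - 2) * (et / s\<^sup>2) \<le> eps / s\<^sup>2"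
    proof -
      have "(p - 1) * h s powr (p - 2) * (et / s\<^sup>2) \<le> (p - 1) * g powr (p - 2) * (et / s\<^sup>2)"
        using p hpos[OF s'] hg[OF s] et
        by (intro mult_right_mono mult_left_mono powr_mono2) auto
      then show ?thesis by (simp add: eps et_def)
    qed
    ultimately have "(p - 1) * h s powr (p - 2) * (p / 2 * (g - h s)\<^sup>2 + et / s\<^sup>2)
       \<le> (p - 1) * h s powr (p - 2) * h1 s"
      using ric[OF s'] unfolding distrib_left by linarith
    then show ?thesis using M[OF s'] by (metis mult_le_cancel_left_pos)
  qed
  \<comment> \<open>The first entry keeps \<open>ln t\<close> nonnegative, the second places
    \<open>exp t\<close> where \<open>h \<le> g\<close> is known.\<close>
  define a where "a = max 1 (ln (ln r0 + 1))"
  have ea: "exp t \<ge> ln r0 + 1" if "t \<ge> a" for t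
  proof -
    have "ln r0 + 1 > 0" using r0' by (simp add: add_pos_pos)
    then show ?thesis using that by (metis a_def exp_le_cancel_iff exp_ln max.bounded_iff)
  qed
  define d where "d t = exp t * (g - h (exp t)) - betab" for t
  define d1 where "d1 t = exp t * (g - h (exp t)) + (- (h1 (exp t) * exp t)) * exp t" for t
  define L where "L t = ln (\<phi> (exp (exp t))) + g * exp t - betab * t" for t
  obtain C where C: "\<And>t. t \<ge> a \<Longrightarrow> L t \<le> C + \<tau> * ln t"
  proof (rule integrated_riccati_bound[of p a L d d1 "betab - beta" betab \<tau>])
    fix t assume t: "t \<ge> a"
    have s: "exp t > ln r0" using ea[OF t] by simp
    then have r: "exp (exp t) > r0" using r0' by (metis exp_less_mono exp_ln less_trans zero_less_one)
    have "((\<lambda>t. \<phi> (exp (exp t))) has_real_derivative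
        (- \<phi> (exp (exp t)) * h (ln (exp (exp t))) / exp (exp t)) * (exp (exp t) * exp t)) (at t)"
      by (rule DERIV_chain2[where f = \<phi> and g = "\<lambda>t. exp (exp t)", OF \<phi>[OF r]]) (auto intro!: derivative_eq_intros)
    then have 1: "((\<lambda>t. \<phi> (exp (exp t))) has_real_derivative - \<phi> (exp (exp t)) * h (exp t) * exp t) (at t)"
      by (simp add: mult.assoc)
    have fp: "\<phi> (exp (exp t)) > 0" using \<phi>pos r by simp
    have "((\<lambda>t. ln (\<phi> (exp (exp t)))) has_real_derivative
        1 / \<phi> (exp (exp t)) * (- \<phi> (exp (exp t)) * h (exp t) * exp t)) (at t)"
      by (rule DERIV_chain2[where f = ln and g = "\<lambda>t. \<phi> (exp (exp t))", OF DERIV_ln_divide[OF fp] 1])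
    then have "((\<lambda>t. ln (\<phi> (exp (exp t)))) has_real_derivative - h (exp t) * exp t) (at t)"
      using fp by simp
    then have "(L has_real_derivative - h (exp t) * exp t + g * exp t - betab * 1) (at t)"
      unfolding L_def by (intro DERIV_add DERIV_diff DERIV_cmult DERIV_exp DERIV_ident)
    then show "(L has_real_derivative d t) (at t)" by (simp add: d_def algebra_simps)
    have "((\<lambda>t. h (exp t)) has_real_derivative h1 (exp t) * exp t) (at t)"
      by (rule DERIV_chain2[where f = h and g = exp, OF h[OF s] DERIV_exp])
    then have "((\<lambda>t. exp t * (g - h (exp t)) - betab) has_real_derivative
        exp t * (g - h (exp t)) + (0 - h1 (exp t) * exp t) * exp t - 0) (at t)"
      by (intro DERIV_diff DERIV_mult DERIV_exp DERIV_const)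
    then show "(d has_real_derivative d1 t) (at t)" unfolding d_def d1_def by simp
    define b where "b = exp t * (g - h (exp t))"
    have "(exp t)\<^sup>2 * (p / 2 * (g - h (exp t))\<^sup>2 + et / (exp t)\<^sup>2) \<le> (exp t)\<^sup>2 * h1 (exp t)"
      using h1[OF ea[OF t]] by (intro mult_left_mono) auto
    then have "p / 2 * b\<^sup>2 + et \<le> (exp t)\<^sup>2 * h1 (exp t)"
      by (simp add: b_def distrib_left power_mult_distrib mult_ac)
    \<comment> \<open>\<open>sum\<close> rewrites the linear term so that the quadratic splits into
      the factors \<open>b - beta\<close> and \<open>b - betab\<close>.\<close>
    then have "d1 t \<le> (p / 2 * (beta + betab)) * b - (p / 2 * b\<^sup>2 + et)"
      unfolding sum by (simp add: d1_def b_def[symmetric] power2_eq_square mult_ac)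
    also have "\<dots> = - (p / 2) * ((b - betab) * ((b - betab) + (betab - beta)))"
      by (simp add: et_def algebra_simps power2_eq_square)
    finally show "d1 t \<le> - (p / 2) * (d t * (d t + (betab - beta)))"
      by (simp add: d_def b_def)
    show "d t \<ge> - betab" using hg[OF ea[OF t]] by (simp add: d_def)
  qed (use p \<tau> in \<open>auto simp: a_def\<close>)
  show thesis
  proof (rule that[of "exp C" "exp (exp a)"])
    fix x :: "real ^ 'n" assume x: "norm x \<ge> exp (exp a)"
    define t where "t = ln (ln (norm x))"
    have n0: "norm x > 0" using x exp_gt_zero[of "exp a"] by linarith
    have ls: "ln (norm x) \<ge> exp a" using x n0 by (metis exp_gt_zero ln_exp ln_le_cancel_iff)
    then have l0: "ln (norm x) > 0" using exp_gt_zero[of a] by linarith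
    have ta: "t \<ge> a" using ls l0 unfolding t_def by (metis exp_gt_zero ln_exp ln_le_cancel_iff)
    have t0: "t > 0" using ta by (simp add: a_def)
    have et': "exp t = ln (norm x)" using l0 by (simp only: t_def exp_ln)
    have eet: "exp (exp t) = norm x" unfolding et' using n0 by simp
    have "ln r0 < exp t" using ea[OF ta] by simp
    then have nr: "norm x > r0" using r0' n0 unfolding et' by simp
    have vx: "v x = \<phi> (norm x)" "v x > 0" using v pos nr by auto
    have "ln (v x) \<le> C - g * ln (norm x) + betab * t + \<tau> * ln t"
      using C[OF ta] unfolding L_def eet unfolding vx(1) et' by linarith
    then have "v x \<le> exp (C - g * ln (norm x) + betab * t + \<tau> * ln t)"
      using vx(2) by (metis exp_le_cancel_iff exp_ln)
    also have "\<dots> = exp C * (norm x powr (- g) * ln (norm x) powr betab * t powr \<tau>)"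
      using n0 l0 t0 by (simp add: powr_def exp_add exp_diff exp_minus t_def divide_inverse mult_ac)
    finally show "v x > 0 \<and> v x \<le> exp C * (norm x powr (- g) * ln (norm x) powr betab * ln (ln (norm x)) powr \<tau>)"
      using vx(2) by (simp add: t_def)
  qed auto
qed

section \<open>The two exponents and the conclusion\<close>

text \<open>Reflecting \<open>b\<close> to \<open>2 / p - b\<close> preserves the quadratic, hence
  maps roots to roots. As \<open>beta\<close> and \<open>betab\<close> are all the roots, possibly
  equal, their sum is \<open>2 / p\<close>; positivity of \<open>beta\<close> then follows from that
  of the product.\<close>

lemma roots_symmetric:
  fixes k p eps beta betab :: real
  assumes p: "p > 0" and k: "k > 0" and eps: "eps > 0"
    and roots: "k * (2 - beta * p) * beta = eps" "k * (2 - betab * p) * betab = eps" "beta \<le> betab"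
      "\<And>b. k * (2 - b * p) * b = eps \<Longrightarrow> b = beta \<or> b = betab"
  shows "p / 2 * (beta + betab) = 1" "eps = k * p * (beta * betab)" "0 < beta"
proof -
  have refl: "k * (2 - (2 / p - b) * p) * (2 / p - b) = k * (2 - b * p) * b" for b
    using p by (simp add: field_simps)
  have "2 / p - beta = beta \<or> 2 / p - beta = betab" "2 / p - betab = beta \<or> 2 / p - betab = betab"
    using roots(4) refl roots(1,2) by metis+
  then have s: "beta + betab = 2 / p" by linarith
  then show "p / 2 * (beta + betab) = 1" using p by simp
  have "2 - beta * p = p * betab" using s p by (simp add: field_simps)
  then show e: "eps = k * p * (beta * betab)" using roots(1) by (simp add: mult_ac)
  have "betab > 0" using s roots(3) p by (smt (verit) divide_pos_pos)
  moreover have "beta * betab > 0" 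
    using eps k p unfolding e by (metis mult_pos_pos zero_less_mult_pos)
  ultimately show "0 < beta" by (simp add: zero_less_mult_iff)
qed

theorem theorem4p5:
  fixes p r0 eps CH Cs beta betab :: real
  assumes N2: "CARD('n) \<ge> 2"
    and p2: "2 \<le> p" and pN: "p < real CARD('n)"
    and r0: "r0 > exp 1"
    and CH: "CH = \<bar>(p - real CARD('n)) / p\<bar> powr p"
    and Cs: "Cs = (p - 1) / (2 * p) * \<bar>(p - real CARD('n)) / p\<bar> powr (p - 2)"
    and eps: "0 < eps" "eps \<le> Cs"
    and roots: "1/2 * \<bar>(p - real CARD('n)) / p\<bar> powr (p - 2) * (p - 1) * (2 - beta * p) * beta = eps"
               "1/2 * \<bar>(p - real CARD('n)) / p\<bar> powr (p - 2) * (p - 1) * (2 - betab * p) * betab = eps"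
               "beta \<le> betab"
               "\<And>b. 1/2 * \<bar>(p - real CARD('n)) / p\<bar> powr (p - 2) * (p - 1) * (2 - b * p) * b = eps
                      \<Longrightarrow> b = beta \<or> b = betab"
  shows
    "(\<forall>(w :: real ^ 'n \<Rightarrow> real) \<tau>.
        (\<forall>x. norm x \<ge> r0 \<longrightarrow> w x > 0) \<and> supersol p CH eps r0 w \<and> \<tau> < 0 \<longrightarrow>
        (\<exists>C>0. \<forall>x. norm x \<ge> r0 \<longrightarrow>
            norm x powr ((p - real CARD('n)) / p) * ln (norm x) powr beta
              * ln (ln (norm x)) powr \<tau> \<le> C * w x))
     \<and>
     (\<forall>(v :: real ^ 'n \<Rightarrow> real) \<tau>.
        (\<forall>x. norm x \<ge> r0 \<longrightarrow> v x > 0) \<and> supersol p CH eps r0 v \<and> radial_strict_decr r0 v \<and>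
        ((eps < Cs \<and> \<tau> > 0) \<or> (eps = Cs \<and> \<tau> > 2 / p)) \<longrightarrow>
        Limsup at_infinity (\<lambda>x. ereal (norm x powr ((p - real CARD('n)) / p) * ln (norm x) powr betab
              * ln (ln (norm x)) powr \<tau> / v x)) > 0)"
proof -
  define g where "g = (real CARD('n) - p) / p"
  have g: "g > 0" using p2 pN by (simp add: g_def)
  have e: "(p - real CARD('n)) / p = - g" by (simp add: g_def minus_divide_left)
  have ag: "\<bar>(p - real CARD('n)) / p\<bar> = g" using g by (simp add: e)
  have CHg: "CH = g powr p" unfolding CH ag ..
  define k where "k = 1/2 * g powr (p - 2) * (p - 1)"
  have k: "k > 0" using g p2 by (simp add: k_def)
  have "p > 0" using p2 by simp
  note S = roots_symmetric[OF this k eps(1) roots[unfolded ag, folded k_def]]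
  have eps': "eps = (p - 1) * g powr (p - 2) * (p / 2 * (beta * betab))"
    using S(2) by (simp add: k_def)
  \<comment> \<open>\<open>Cs\<close> is the value of the quadratic at its vertex
    \<open>1 / p\<close>, so this is the discriminant up to a factor: \<open>eps = Cs\<close> holds
    exactly when the roots coincide.\<close>
  have gap: "Cs - eps = k * p / 4 * (betab - beta)\<^sup>2"
  proof -
    have b: "beta + betab = 2 / p" using S(1) p2 by (simp add: field_simps)
    have "k * p / 4 * (betab - beta)\<^sup>2 = k * p / 4 * (beta + betab)\<^sup>2 - eps"
      using S(2) by (simp add: power2_eq_square algebra_simps)
    also have "k * p / 4 * (beta + betab)\<^sup>2 = Cs"
      unfolding b Cs ag k_def using p2 by (simp add: field_simps power2_eq_square)
    finally show ?thesis by simp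
  qed
  have kp: "k * p / 4 > 0" using k p2 by simp
  show ?thesis
    unfolding ag e
  proof (intro conjI allI impI; elim conjE)
    fix w :: "real ^ 'n \<Rightarrow> real" and \<tau> :: real
    assume w: "\<forall>x. norm x \<ge> r0 \<longrightarrow> w x > 0" "supersol p CH eps r0 w" and \<tau>: "\<tau> < 0"
    have "- \<tau> > 0" using \<tau> by simp
    from supersolution_lower_bound[OF p2 g_def g r0 S(3) roots(3) S(1) eps' this _ w(2)[unfolded CHg]] w(1)
    show "\<exists>C>0. \<forall>x. norm x \<ge> r0 \<longrightarrow>
        norm x powr (- g) * ln (norm x) powr beta * ln (ln (norm x)) powr \<tau> \<le> C * w x"
      by simp
  next
    fix v :: "real ^ 'n \<Rightarrow> real" and \<tau> :: real
    assume v: "\<forall>x. norm x \<ge> r0 \<longrightarrow> v x > 0" "supersol p CH eps r0 v" "radial_strict_decr r0 v"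
      and \<tau>: "eps < Cs \<and> \<tau> > 0 \<or> eps = Cs \<and> \<tau> > 2 / p"
    have \<tau>': "(beta < betab \<and> \<tau> > 0) \<or> (beta = betab \<and> \<tau> > 2 / p)"
    proof -
      have "eps < Cs \<longrightarrow> beta \<noteq> betab" using gap by auto
      moreover have "beta = betab" if "eps = Cs"
      proof -
        have "k * p / 4 * (betab - beta)\<^sup>2 = 0" using gap that by simp
        then have "(betab - beta)\<^sup>2 = 0" using kp by (metis mult_eq_0_iff less_irrefl)
        then show ?thesis by simp
      qed
      ultimately show ?thesis using \<tau> roots(3) by auto
    qed
    define q where "q x = norm x powr (- g) * ln (norm x) powr betab * ln (ln (norm x)) powr \<tau>" for x :: "real ^ 'n"
    obtain C r1 where C: "C > 0" and
      b: "\<And>x. norm x \<ge> r1 \<Longrightarrow> v x > 0 \<and> v x \<le> C * q x"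
      unfolding q_def
      by (rule radial_supersolution_upper_bound[OF p2 g_def g r0 S(3) roots(3) S(1) eps' \<tau>' _ v(2)[unfolded CHg] v(3)])
         (use v(1) in auto)
    have "\<forall>\<^sub>F x in at_infinity. ereal (1 / C) \<le> ereal (q x / v x)"
      unfolding eventually_at_infinity
    proof (intro exI allI impI)
      fix x :: "real ^ 'n" assume "r1 \<le> norm x"
      from b[OF this] C show "ereal (1 / C) \<le> ereal (q x / v x)" by (simp add: field_simps)
    qed
    \<comment> \<open>The bound holds for all large \<open>norm x\<close> and passes to the
      \<open>Limsup\<close> because \<open>at_infinity\<close> is a nontrivial filter.\<close>
    then have "ereal (1 / C) \<le> Limsup at_infinity (\<lambda>x. ereal (q x / v x))"
      using trivial_limit_at_infinity[where 'a = "real ^ 'n"]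
      by (intro le_Limsup) (auto simp: trivial_limit_def)
    moreover have "0 < ereal (1 / C)" using C by simp
    ultimately show "Limsup at_infinity (\<lambda>x. ereal (norm x powr (- g) * ln (norm x) powr betab
              * ln (ln (norm x)) powr \<tau> / v x)) > 0"
      unfolding q_def by (rule less_le_trans[rotated])
  qed
qed

end
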